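(* Let $k\ge2$ and let $\mathcal{E}$ be an ensemble of circuits implementing orthogonal $n$-qubit unitaries which is an $\varepsilon$-approximate additive-error unitary $k$-design over the orthogonal group $\mathrm{O}(2^n)$ with $\varepsilon<1/4$. Then at least one circuit in the ensemble has a lightcone containing at least a $1/4$ fraction of the $n$ qubits. Consequently, $\mathcal{E}$ must have circuit depth $d=\Omega(n)$ if the circuits are one-dimensional, and $d=\Omega(\log n)$ if the circuits have all-to-all connectivity.
   Context: $\mathrm{O}(2^n)$ is the group of real unitary matrices on $\mathcal{H}=(\mathbb{C}^2)^{\otimes n}$ (in the computational basis). For an ensemble (probability distribution) $\mathcal{E}$ of unitaries on $\mathcal{H}$, the $k$-wise twirl is $\Phi^{(k)}_{\mathcal{E}}(A)=\mathbb{E}_{U\sim\mathcal{E}}U^{\otimes k}A\,U^{\dagger,\otimes k}$; $\Phi^{(k)}_G$ is the twirl over the Haar measure of a compact group $G$. $\mathcal{E}$ is an $\varepsilon$-approximate additive-error unitary $k$-design over $G$ if $\mathcal{E}$ is supported on $G$ and $\|\Phi_G^{(k)}-\Phi_{\mathcal{E}}^{(k)}\|_\diamond\le\varepsilon$ (diamond norm). Circuits: a depth-$d$ circuit is a product $U=U_d\cdots U_1$ of $d$ layers; each layer is a product of gates with disjoint supports, each gate acting on at most a constant number $r$ of qubits that are connected in the architecture graph (vertices = qubits). One-dimensional: the graph is a path or cycle; all-to-all: the complete graph. The individual gates need not belong to the group, only the total unitary. The depth of an ensemble is the maximal depth of its circuits. The implied constants in $\Omega(\cdot)$ may depend on $r$.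 Lightcone: fix an arbitrary ordering of the qubits. The lightcone of a circuit is the lightcone starting from the first qubit, i.e. the set $S_d$ defined by $S_0=\{1\}$ and $S_t=S_{t-1}\cup\bigcup\{\text{supports of gates in layer } t \text{ that intersect } S_{t-1}\}$. *)

theory Defs
  imports "HOL-Probability.Probability" "Jordan_Normal_Form.Schur_Decomposition"
begin

section \<open>Matrices, groups and Haar measure\<close>

definition kron :: "complex mat \<Rightarrow> complex mat \<Rightarrow> complex mat" where
  "kron A B = mat (dim_row A * dim_row B) (dim_col A * dim_col B)
     (\<lambda>(i, j). A $$ (i div dim_row B, j div dim_col B) * B $$ (i mod dim_row B, j mod dim_col B))"

primrec tensor_power :: "nat \<Rightarrow> complex mat \<Rightarrow> complex mat" where
  "tensor_power 0 A = 1\<^sub>m 1"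
| "tensor_power (Suc k) A = kron A (tensor_power k A)"

definition unitary_group :: "nat \<Rightarrow> complex mat set" where
  "unitary_group d = {U \<in> carrier_mat d d. mat_adjoint U * U = 1\<^sub>m d}"

definition orthogonal_group :: "nat \<Rightarrow> complex mat set" where
  "orthogonal_group d = {U \<in> unitary_group d. \<forall>i<d. \<forall>j<d. U $$ (i, j) \<in> \<real>}"

text \<open>The type of matrices carries no topology. The Borel sigma-algebra on the \<open>d \<times> d\<close> matrices
  is the one generated by the matrix entries.\<close>

definition mat_borel :: "nat \<Rightarrow> complex mat measure" where
  "mat_borel d = sigma (carrier_mat d d)
     {{A \<in> carrier_mat d d. A $$ (i, j) \<in> B} | i j B. i < d \<and> j < d \<and> B \<in> sets borel}"

definition is_haar :: "nat \<Rightarrow> complex mat set \<Rightarrow> complex mat measure \<Rightarrow> bool" where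
  "is_haar d G \<mu> \<longleftrightarrow>
     prob_space \<mu> \<and> sets \<mu> = sets (mat_borel d) \<and> (AE U in \<mu>. U \<in> G) \<and>
     (\<forall>V\<in>G. distr \<mu> (mat_borel d) (\<lambda>U. V * U) = \<mu> \<and> distr \<mu> (mat_borel d) (\<lambda>U. U * V) = \<mu>)"

section \<open>Twirls, diamond norm and approximate designs\<close>

text \<open>The expectation of a random matrix is taken entrywise.\<close>

definition twirl :: "nat \<Rightarrow> nat \<Rightarrow> complex mat measure \<Rightarrow> complex mat \<Rightarrow> complex mat" where
  "twirl d k \<nu> A = mat (d ^ k) (d ^ k)
     (\<lambda>(i, j). \<integral>U. (tensor_power k U * A * tensor_power k (mat_adjoint U)) $$ (i, j) \<partial>\<nu>)"

text \<open>The sum of the singular values of a square matrix: \<open>proots\<close> lists the (real, nonnegative)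
  eigenvalues of \<open>A\<^sup>\<dagger> A\<close> with multiplicity.\<close>

definition trace_norm :: "complex mat \<Rightarrow> real" where
  "trace_norm A = (\<Sum>x\<in>#proots (char_poly (mat_adjoint A * A)). sqrt (Re x))"

text \<open>\<open>ampliation d m \<Phi>\<close> is \<open>\<Phi> \<otimes> id\<close> for a linear map \<open>\<Phi>\<close> on \<open>d \<times> d\<close> matrices and an ancilla of
  dimension \<open>m\<close>. The index \<open>p * m + a\<close> stands for the basis vector \<open>p \<otimes> a\<close>, as in \<open>kron\<close>,
  so that \<open>\<Phi>\<close> is applied to each of the \<open>m \<times> m\<close> blocks belonging to a pair of ancilla indices.\<close>

definition ampliation ::
  "nat \<Rightarrow> nat \<Rightarrow> (complex mat \<Rightarrow> complex mat) \<Rightarrow> complex mat \<Rightarrow> complex mat" where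
  "ampliation d m \<Phi> X = mat (d * m) (d * m)
     (\<lambda>(i, j). \<Phi> (mat d d (\<lambda>(p, q). X $$ (p * m + i mod m, q * m + j mod m))) $$ (i div m, j div m))"

text \<open>Taking the supremum in the extended reals avoids a boundedness side condition;
  for linear maps it is finite.\<close>

definition diamond_norm :: "nat \<Rightarrow> (complex mat \<Rightarrow> complex mat) \<Rightarrow> ereal" where
  "diamond_norm d \<Phi> =
     (SUP (m, X) \<in> {(m, X). 0 < m \<and> X \<in> carrier_mat (d * m) (d * m) \<and> trace_norm X \<le> 1}.
        ereal (trace_norm (ampliation d m \<Phi> X)))"

text \<open>The distribution \<open>\<nu>\<close> of the random unitary is an \<open>\<epsilon>\<close>-approximate additive-error unitary
  \<open>k\<close>-design over the compact group \<open>G\<close>. Haar measure on a compact group exists and is unique,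
  so the quantifier over \<open>\<mu>\<close> just names it.\<close>

definition approx_design ::
  "nat \<Rightarrow> nat \<Rightarrow> real \<Rightarrow> complex mat set \<Rightarrow> complex mat measure \<Rightarrow> bool" where
  "approx_design d k \<epsilon> G \<nu> \<longleftrightarrow>
     (AE U in \<nu>. U \<in> G) \<and>
     (\<exists>\<mu>. is_haar d G \<mu> \<and>
          diamond_norm (d ^ k) (\<lambda>A. twirl d k \<mu> A - twirl d k \<nu> A) \<le> ereal \<epsilon>)"

section \<open>Circuits\<close>

text \<open>The qubits are \<open>0, \<dots>, n - 1\<close>, and the index \<open>x < 2 ^ n\<close> denotes the computational basis
  state in which qubit \<open>q\<close> has value \<open>bit x q\<close>. A gate is given by its support together with
  the operator it induces on all qubits; \<open>acts_on n S U\<close> says that this operator has the form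
  \<open>g \<otimes> 1\<close> with \<open>g\<close> acting on the qubits in \<open>S\<close>.\<close>

type_synonym gate = "nat set \<times> complex mat"
type_synonym layer = "gate list"
type_synonym circuit = "layer list"

definition acts_on :: "nat \<Rightarrow> nat set \<Rightarrow> complex mat \<Rightarrow> bool" where
  "acts_on n S U \<longleftrightarrow>
     (\<exists>g :: nat set \<Rightarrow> nat set \<Rightarrow> complex. \<forall>x<2 ^ n. \<forall>y<2 ^ n.
        U $$ (x, y) =
          (if \<forall>q\<in>{..<n} - S. bit x q = bit y q then g {q \<in> S. bit x q} {q \<in> S. bit y q} else 0))"

definition architecture :: "nat \<Rightarrow> (nat \<times> nat) set \<Rightarrow> bool" where
  "architecture n E \<longleftrightarrow> E \<subseteq> {..<n} \<times> {..<n} \<and> sym E"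

definition path_architecture :: "nat \<Rightarrow> (nat \<times> nat) set" where
  "path_architecture n = {(i, j). i < n \<and> j < n \<and> (j = i + 1 \<or> i = j + 1)}"

definition cycle_architecture :: "nat \<Rightarrow> (nat \<times> nat) set" where
  "cycle_architecture n = {(i, j). i < n \<and> j < n \<and> (j = (i + 1) mod n \<or> i = (j + 1) mod n)}"

definition complete_architecture :: "nat \<Rightarrow> (nat \<times> nat) set" where
  "complete_architecture n = {(i, j). i < n \<and> j < n \<and> i \<noteq> j}"

definition connected_in :: "(nat \<times> nat) set \<Rightarrow> nat set \<Rightarrow> bool" where
  "connected_in E S \<longleftrightarrow> (\<forall>x\<in>S. \<forall>y\<in>S. (x, y) \<in> (E \<inter> S \<times> S)\<^sup>*)"

definition valid_gate :: "nat \<Rightarrow> nat \<Rightarrow> (nat \<times> nat) set \<Rightarrow> gate \<Rightarrow> bool" where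
  "valid_gate n r E = (\<lambda>(S, U).
     S \<subseteq> {..<n} \<and> card S \<le> r \<and> connected_in E S \<and> U \<in> unitary_group (2 ^ n) \<and> acts_on n S U)"

definition valid_layer :: "nat \<Rightarrow> nat \<Rightarrow> (nat \<times> nat) set \<Rightarrow> layer \<Rightarrow> bool" where
  "valid_layer n r E L \<longleftrightarrow>
     (\<forall>g\<in>set L. valid_gate n r E g) \<and>
     (\<forall>i<length L. \<forall>j<length L. i \<noteq> j \<longrightarrow> fst (L ! i) \<inter> fst (L ! j) = {})"

definition layer_unitary :: "nat \<Rightarrow> layer \<Rightarrow> complex mat" where
  "layer_unitary n L = foldr (\<lambda>g A. snd g * A) L (1\<^sub>m (2 ^ n))"

text \<open>The first layer in the list is applied first, i.e. it is the rightmost factor.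
  The depth of a circuit is the length of the list.\<close>

definition circuit_unitary :: "nat \<Rightarrow> circuit \<Rightarrow> complex mat" where
  "circuit_unitary n C = foldl (\<lambda>A L. layer_unitary n L * A) (1\<^sub>m (2 ^ n)) C"

definition lightcone :: "nat \<Rightarrow> circuit \<Rightarrow> nat set" where
  "lightcone q C = foldl (\<lambda>S L. S \<union> \<Union>{fst g | g. g \<in> set L \<and> fst g \<inter> S \<noteq> {}}) {q} C"

section \<open>Ensembles of circuits\<close>

text \<open>An ensemble is a probability measure on a set \<open>space M\<close> of circuits, with any sigma-algebra
  that makes the implemented unitary a random variable.\<close>

definition circuit_ensemble :: "nat \<Rightarrow> nat \<Rightarrow> (nat \<times> nat) set \<Rightarrow> circuit measure \<Rightarrow> bool" where
  "circuit_ensemble n r E M \<longleftrightarrow>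
     prob_space M \<and>
     (\<forall>C\<in>space M. \<forall>L\<in>set C. valid_layer n r E L) \<and>
     circuit_unitary n \<in> measurable M (mat_borel (2 ^ n))"

definition orthogonal_design_ensemble ::
  "nat \<Rightarrow> nat \<Rightarrow> real \<Rightarrow> nat \<Rightarrow> (nat \<times> nat) set \<Rightarrow> circuit measure \<Rightarrow> bool" where
  "orthogonal_design_ensemble n k \<epsilon> r E M \<longleftrightarrow>
     circuit_ensemble n r E M \<and>
     (\<forall>C\<in>space M. circuit_unitary n C \<in> orthogonal_group (2 ^ n)) \<and>
     approx_design (2 ^ n) k \<epsilon> (orthogonal_group (2 ^ n))
       (distr M (mat_borel (2 ^ n)) (circuit_unitary n))"

text \<open>The maximal depth, which is infinite if the depths are unbounded.\<close>

definition ensemble_depth :: "circuit measure \<Rightarrow> ereal" where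
  "ensemble_depth M = (SUP C\<in>space M. ereal (real (length C)))"

end

theory Submission
  imports Defs
begin

text \<open>Let \<open>B = iY\<close> act on qubit \<open>q\<close> of one half of a maximally entangled state of two copies of the
  system. An orthogonal \<open>U\<close> applied to both copies leaves the entangled state fixed, so it only turns
  \<open>B\<close> into \<open>P = U B U\<^sup>\<dagger>\<close>. For a circuit, \<open>P\<close> acts on the lightcone of \<open>q\<close> only, so \<open>X\<^sub>j \<otimes> X\<^sub>j\<close> has
  expectation \<open>1\<close> for every qubit \<open>j\<close> outside of it, and at least \<open>-1\<close> inside. If all lightcones had
  fewer than \<open>n / 4\<close> qubits, the average over \<open>j\<close> would exceed \<open>1 / 2\<close>. For Haar random \<open>U\<close> the matrix
  \<open>P\<close> is antisymmetric and invariant under conjugation by diagonal signs, which already forces a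
  nonpositive expectation for each \<open>j\<close>. As each \<open>X\<^sub>j \<otimes> X\<^sub>j\<close> is unitary, the difference is at most the
  trace norm distance of the two twirled states, hence at most \<open>\<epsilon> < 1 / 4\<close>, a contradiction.\<close>

section \<open>Unitary matrices and the trace norm\<close>

text \<open>Two copies are enough because (U \<otimes> U) vec(B) = vec(U B U^T), and U^T is the
  adjoint of U when U is real. The entanglement thus lies between two of the k copies, so the
  diamond norm is tested with a trivial ancilla only, and further copies are padded with a fixed
  basis state. The Pauli matrix is chosen antisymmetric for its signs. In the Haar average, the
  products of entries of P that survive the sign symmetries are those of two diagonal entries and
  those of P(a,b) with P(b,a), where b is the flip of a. Antisymmetry makes the former vanish and
  the latter minus a square, so no Haar moment has to be computed; a real symmetric P would leave
  nonnegative terms to be estimated. On the matrix side the obstacle is the trace norm, given by the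
  roots of the characteristic polynomial of \<open>A\<^sup>\<dagger> A\<close>. Both facts needed
  about it, the duality bound against unitaries and the value on pure states, are read off a
  triangular form in a unitary basis.\<close>

lemma index_mult_mat_sum:
  assumes "A \<in> carrier_mat n m" "B \<in> carrier_mat m p" "i < n" "j < p"
  shows "(A * B) $$ (i, j) = (\<Sum>k<m. A $$ (i, k) * B $$ (k, j))"
  using assms by (auto simp: scalar_prod_def atLeast0LessThan intro!: sum.cong)

lemma index_mult_mat3_sum:
  assumes "A \<in> carrier_mat n m" "B \<in> carrier_mat m p" "C \<in> carrier_mat p q" "i < n" "j < q"
  shows "(A * B * C) $$ (i, j) = (\<Sum>k<m. \<Sum>l<p. A $$ (i, k) * B $$ (k, l) * C $$ (l, j))"
proof -
  have "(A * B * C) $$ (i, j) = (\<Sum>l<p. (\<Sum>k<m. A $$ (i, k) * B $$ (k, l)) * C $$ (l, j))"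
    using assms by (simp add: index_mult_mat_sum[of "A * B" n p C q] index_mult_mat_sum[of A n m B p]
        del: index_mult_mat(1) assoc_mult_mat)
  also have "\<dots> = (\<Sum>k<m. \<Sum>l<p. A $$ (i, k) * B $$ (k, l) * C $$ (l, j))"
    by (subst sum.swap) (simp add: sum_distrib_right)
  finally show ?thesis .
qed

lemma mult_carrier_square [simp]:
  "A \<in> carrier_mat n n \<Longrightarrow> B \<in> carrier_mat n n \<Longrightarrow> A * B \<in> carrier_mat n n"
  by (rule mult_carrier_mat)

lemma mat_adjoint_carrier [simp]: "A \<in> carrier_mat n m \<Longrightarrow> mat_adjoint A \<in> carrier_mat m n"
  unfolding mat_adjoint_def by auto

lemma mat_adjoint_dim [simp]: "dim_row (mat_adjoint A) = dim_col A" "dim_col (mat_adjoint A) = dim_row A"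
  unfolding mat_adjoint_def by auto

lemma mat_adjoint_index [simp]:
  "i < dim_col A \<Longrightarrow> j < dim_row A \<Longrightarrow> mat_adjoint (A :: complex mat) $$ (i, j) = cnj (A $$ (j, i))"
  unfolding mat_adjoint_def by (simp add: mat_of_rows_index)

lemma mat_adjoint_adjoint [simp]: "mat_adjoint (mat_adjoint A) = (A :: complex mat)"
  by (rule eq_matI) auto

lemma mat_adjoint_one [simp]: "mat_adjoint (1\<^sub>m n :: complex mat) = 1\<^sub>m n"
  by (rule eq_matI) auto

lemma mat_adjoint_mult:
  assumes "A \<in> carrier_mat n m" "(B :: complex mat) \<in> carrier_mat m p"
  shows "mat_adjoint (A * B) = mat_adjoint B * mat_adjoint A"
proof (rule eq_matI)
  fix i j assume "i < dim_row (mat_adjoint B * mat_adjoint A)" "j < dim_col (mat_adjoint B * mat_adjoint A)"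
  then have ij: "i < p" "j < n" using assms by auto
  have "mat_adjoint (A * B) $$ (i, j) = cnj ((A * B) $$ (j, i))"
    using assms ij by simp
  also have "\<dots> = (mat_adjoint B * mat_adjoint A) $$ (i, j)"
    using assms ij by (simp add: index_mult_mat_sum[of A n m B p]
        index_mult_mat_sum[of "mat_adjoint B" p m "mat_adjoint A" n] mult.commute del: index_mult_mat)
  finally show "mat_adjoint (A * B) $$ (i, j) = (mat_adjoint B * mat_adjoint A) $$ (i, j)" .
qed (use assms in auto)

lemma unitary_groupD:
  assumes "U \<in> unitary_group n"
  shows "U \<in> carrier_mat n n" "mat_adjoint U * U = 1\<^sub>m n" "U * mat_adjoint U = 1\<^sub>m n"
  using assms mat_mult_left_right_inverse[of "mat_adjoint U" n U]
  unfolding unitary_group_def by auto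

lemma unitary_group_adjoint: "U \<in> unitary_group n \<Longrightarrow> mat_adjoint U \<in> unitary_group n"
  using unitary_groupD(1,3)[of U n] by (simp add: unitary_group_def)

lemma unitary_group_one: "1\<^sub>m n \<in> unitary_group n"
  unfolding unitary_group_def by auto

lemma unitary_group_mult:
  assumes "U \<in> unitary_group n" "V \<in> unitary_group n"
  shows "U * V \<in> unitary_group n"
proof -
  note U = unitary_groupD[OF assms(1)] and V = unitary_groupD[OF assms(2)]
  have "mat_adjoint (U * V) * (U * V) = mat_adjoint V * mat_adjoint U * (U * V)"
    by (simp add: mat_adjoint_mult[OF U(1) V(1)])
  also have "\<dots> = mat_adjoint V * (mat_adjoint U * U * V)"
    using U(1) V(1) by (simp add: assoc_mult_mat[of _ n n _ n _ n])
  finally show ?thesis using U V unfolding unitary_group_def by simp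
qed

lemma unitary_row_norm:
  assumes "U \<in> unitary_group n" "i < n"
  shows "(\<Sum>j<n. (cmod (U $$ (i, j)))\<^sup>2) = 1"
proof -
  note U = unitary_groupD[OF assms(1)]
  have "complex_of_real (\<Sum>j<n. (cmod (U $$ (i, j)))\<^sup>2) = (U * mat_adjoint U) $$ (i, i)"
    using U(1) assms(2)
    by (simp add: index_mult_mat_sum[of U n n _ n] complex_norm_square del: index_mult_mat of_real_power)
  also have "\<dots> = complex_of_real 1" using U(3) assms(2) by simp
  finally show ?thesis by (simp only: of_real_eq_iff)
qed

lemma unitary_col_norm:
  assumes "U \<in> unitary_group n" "j < n"
  shows "(\<Sum>i<n. (cmod (U $$ (i, j)))\<^sup>2) = 1"
  using unitary_row_norm[OF unitary_group_adjoint[OF assms(1)] assms(2)]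
    unitary_groupD(1)[OF assms(1)] assms(2) by simp

lemma unitary_entry_le_1:
  assumes "U \<in> unitary_group n" "i < n" "j < n"
  shows "cmod (U $$ (i, j)) \<le> 1"
proof -
  have "(cmod (U $$ (i, j)))\<^sup>2 \<le> (\<Sum>j<n. (cmod (U $$ (i, j)))\<^sup>2)"
    by (rule member_le_sum) (use assms in auto)
  then show ?thesis using unitary_row_norm[OF assms(1,2)] by (simp add: abs_square_le_1)
qed

section \<open>The trace and unitary triangularisation\<close>

definition mat_trace :: "complex mat \<Rightarrow> complex" where
  "mat_trace A = (\<Sum>i<dim_row A. A $$ (i, i))"

lemma mat_trace_mult_comm:
  assumes "A \<in> carrier_mat n m" "B \<in> carrier_mat m n"
  shows "mat_trace (A * B) = mat_trace (B * A)"
proof -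
  have "mat_trace (A * B) = (\<Sum>i<n. \<Sum>k<m. A $$ (i, k) * B $$ (k, i))"
    using assms by (simp add: mat_trace_def index_mult_mat_sum[of A n m B n] del: index_mult_mat(1))
  also have "\<dots> = (\<Sum>k<m. \<Sum>i<n. B $$ (k, i) * A $$ (i, k))"
    by (subst sum.swap) (simp add: mult.commute)
  also have "\<dots> = mat_trace (B * A)"
    using assms by (simp add: mat_trace_def index_mult_mat_sum[of B m n A m] del: index_mult_mat(1))
  finally show ?thesis .
qed

text \<open>Gram-Schmidt on a basis that starts with \<open>v\<close> leaves the first vector
  unchanged, and dividing by the lengths makes the columns orthonormal. The first column is
  therefore \<open>v\<close> only up to a nonzero scalar, which is harmless for an
  eigenvector.\<close>

lemma unitary_with_first_column:
  fixes v :: "complex vec"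
  assumes v: "v \<in> carrier_vec n" "v \<noteq> 0\<^sub>v n" and n: "n \<noteq> 0"
  obtains W c where "W \<in> unitary_group n" "c \<noteq> 0" "col W 0 = c \<cdot>\<^sub>v v"
proof -
  interpret cof_vec_space n "TYPE(complex)" .
  define b where "b = basis_completion v"
  define ws where "ws = gram_schmidt n b"
  from basis_completion[OF v, folded b_def]
  have b: "distinct b" "\<not> lin_dep (set b)" "set b \<subseteq> carrier_vec n" "hd b = v" "length b = n" by auto
  from gram_schmidt_result[OF b(3) b(1) b(2) refl, folded ws_def] b(5)
  have ws: "set ws \<subseteq> carrier_vec n" "corthogonal ws" "length ws = n" by auto
  from b(4,5) n obtain vs where bv: "b = v # vs" by (cases b) auto
  have hd: "hd ws = v" using gram_schmidt_hd[OF v(1), of vs] unfolding ws_def bv .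
  then have ws0: "ws ! 0 = v" using ws(3) n by (cases ws) auto
  have wsc: "ws ! i \<in> carrier_vec n" if "i < n" for i using that ws by auto
  define r where "r i = sqrt (\<Sum>k<n. (cmod (ws ! i $ k))\<^sup>2)" for i
  have sp: "ws ! j \<bullet>c ws ! i = (\<Sum>k<n. ws ! j $ k * cnj (ws ! i $ k))" if "i < n" "j < n" for i j
    using wsc[OF that(1)] wsc[OF that(2)]
    by (auto simp: scalar_prod_def atLeast0LessThan intro!: sum.cong)
  have rr: "complex_of_real (r i * r i) = ws ! i \<bullet>c ws ! i" if "i < n" for i
  proof -
    have "r i * r i = (\<Sum>k<n. (cmod (ws ! i $ k))\<^sup>2)"
      by (simp add: r_def sum_nonneg)
    then show ?thesis by (simp only: of_real_sum complex_norm_square sp[OF that that])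
  qed
  \<comment> \<open>\<open>corthogonal\<close> is an equivalence: the product vanishes exactly for
    distinct indices. Its diagonal case says that no vector has length zero.\<close>
  have r0: "r i \<noteq> 0" if "i < n" for i
    using rr[OF that] ws(2)[unfolded corthogonal_def, rule_format, of i i] that ws(3) by auto
  define W where "W = mat n n (\<lambda>(k, i). ws ! i $ k / complex_of_real (r i))"
  have W: "W \<in> carrier_mat n n" by (simp add: W_def)
  have "mat_adjoint W * W = 1\<^sub>m n"
  proof (rule eq_matI)
    fix i j assume "i < dim_row (1\<^sub>m n :: complex mat)" "j < dim_col (1\<^sub>m n :: complex mat)"
    then have ij: "i < n" "j < n" by auto
    have "(mat_adjoint W * W) $$ (i, j) = (\<Sum>k<n. cnj (ws ! i $ k) / r i * (ws ! j $ k / r j))"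
    proof -
      have "W $$ (k, l) = ws ! l $ k / complex_of_real (r l)" if "k < n" "l < n" for k l
        using that by (simp add: W_def)
      then show ?thesis using W ij by (simp add: index_mult_mat_sum[of _ n n W n] del: index_mult_mat)
    qed
    also have "\<dots> = (ws ! j \<bullet>c ws ! i) / (r i * r j)"
      by (simp add: sp[OF ij] sum_divide_distrib mult.commute)
    also have "\<dots> = 1\<^sub>m n $$ (i, j)"
    proof (cases "i = j")
      case True
      then show ?thesis using r0[OF ij(1)] ij by (simp flip: rr[OF ij(2)])
    next
      case False
      then have "ws ! j \<bullet>c ws ! i = 0"
        using ws(2,3) ij unfolding corthogonal_def by auto
      then show ?thesis using ij False by simp
    qed
    finally show "(mat_adjoint W * W) $$ (i, j) = 1\<^sub>m n $$ (i, j)" .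
  qed (use W in auto)
  then have "W \<in> unitary_group n" using W by (simp add: unitary_group_def)
  moreover have "col W 0 = complex_of_real (1 / r 0) \<cdot>\<^sub>v v"
    using n v W by (intro eq_vecI) (auto simp: W_def ws0)
  moreover have "complex_of_real (1 / r 0) \<noteq> 0" using r0 n by simp
  ultimately show ?thesis using that by blast
qed
lemma block_diag_unitary:
  assumes "V \<in> unitary_group n"
  shows "four_block_mat (1\<^sub>m 1) (0\<^sub>m 1 n) (0\<^sub>m n 1) V \<in> unitary_group (1 + n)"
    (is "?B \<in> _")
proof -
  note V = unitary_groupD[OF assms]
  have c: "?B \<in> carrier_mat (1 + n) (1 + n)" using V(1) by (intro four_block_carrier_mat) auto
  have adj: "mat_adjoint ?B = four_block_mat (1\<^sub>m 1) (0\<^sub>m 1 n) (0\<^sub>m n 1) (mat_adjoint V)"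
    using V(1) by (intro eq_matI) auto
  have "mat_adjoint ?B * ?B = four_block_mat (1\<^sub>m 1) (0\<^sub>m 1 n) (0\<^sub>m n 1) (1\<^sub>m n)"
    unfolding adj using V by (subst mult_four_block_mat[of _ 1 1 _ n _ n _ _ 1 _ n]) auto
  also have "\<dots> = 1\<^sub>m (1 + n)" by (rule eq_matI) auto
  finally show ?thesis using c unfolding unitary_group_def by blast
qed

text \<open>The library provides the triangularisation only with an invertible, not a unitary, change of
  basis, since its Gram-Schmidt process does not normalise.\<close>

lemma unitary_triangularisation:
  fixes A :: "complex mat"
  assumes "A \<in> carrier_mat n n" "char_poly A = (\<Prod>e\<leftarrow>es. [:- e, 1:])"
  shows "\<exists>V\<in>unitary_group n. diag_mat (mat_adjoint V * A * V) = es"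
  using assms
proof (induction es arbitrary: n A)
  case Nil
  with degree_monic_char_poly[of A n] have "n = 0" by simp
  with Nil show ?case by (intro bexI[of _ "1\<^sub>m 0"]) (auto simp: unitary_group_one diag_mat_def)
next
  case (Cons e es)
  note A = Cons.prems(1)
  define m where "m = n - 1"
  have cp: "char_poly A = [:- e, 1:] * (\<Prod>e\<leftarrow>es. [:- e, 1:])" using Cons.prems(2) by simp
  have mon: "monic (\<Prod>e\<leftarrow>es. [:- e, 1:])" by (rule monic_prod_list) auto
  have "degree (char_poly A) = Suc (degree (\<Prod>e\<leftarrow>es. [:- e, 1:]))"
    unfolding cp using mon by (subst degree_mult_eq) auto
  with degree_monic_char_poly[OF A] have n0: "n \<noteq> 0" by auto
  then have n: "n = 1 + m" by (simp add: m_def)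
  have "eigenvalue A e" unfolding eigenvalue_root_char_poly[OF A] cp by simp
  then obtain v where v: "v \<in> carrier_vec n" "v \<noteq> 0\<^sub>v n" "A *\<^sub>v v = e \<cdot>\<^sub>v v"
    using A unfolding eigenvalue_def eigenvector_def by auto
  obtain W c where W: "W \<in> unitary_group n" and c: "c \<noteq> 0" "col W 0 = c \<cdot>\<^sub>v v"
    using unitary_with_first_column[OF v(1,2) n0] by blast
  note W' = unitary_groupD[OF W]
  define B where "B = mat_adjoint W * A * W"
  have B: "B \<in> carrier_mat n n" using A W' by (simp add: B_def)
  have "A *\<^sub>v col W 0 = e \<cdot>\<^sub>v col W 0"
    using A v c by (simp add: mult_mat_vec smult_smult_assoc mult.commute)
  then have AW: "col (A * W) 0 = e \<cdot>\<^sub>v col W 0"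
    using col_mult2[OF A W'(1), of 0] n0 by (simp del: col_mult col_mult2)
  \<comment> \<open>Column \<open>0\<close> of \<open>A * W\<close> is a multiple of column
    \<open>0\<close> of \<open>W\<close>, and the rows of the adjoint of \<open>W\<close> are
    orthogonal to that column except for the first one.\<close>
  have B0: "B $$ (i, 0) = (if i = 0 then e else 0)" if "i < n" for i
  proof -
    have "B $$ (i, 0) = row (mat_adjoint W) i \<bullet> col (A * W) 0"
      using A W' that n0 unfolding B_def by (subst assoc_mult_mat[of _ n n _ n _ n]) auto
    also have "\<dots> = e * (row (mat_adjoint W) i \<bullet> col W 0)"
      unfolding AW using W' that n0 by (intro scalar_prod_smult_distrib[of _ n]) auto
    also have "row (mat_adjoint W) i \<bullet> col W 0 = (mat_adjoint W * W) $$ (i, 0)"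
      using W'(1) that n0 by simp
    finally show ?thesis using W'(2) that n0 by simp
  qed
  define A2 where "A2 = mat 1 m (\<lambda>(i, j). B $$ (0, Suc j))"
  define A3 where "A3 = mat m m (\<lambda>(i, j). B $$ (Suc i, Suc j))"
  have A2: "A2 \<in> carrier_mat 1 m" and A3: "A3 \<in> carrier_mat m m" by (auto simp: A2_def A3_def)
  have Bblock: "B = four_block_mat (mat 1 1 (\<lambda>_. e)) A2 (0\<^sub>m m 1) A3"
    using B n B0 by (intro eq_matI) (auto simp: A2_def A3_def)
  \<comment> \<open>Similarity preserves the characteristic polynomial, so cancelling the linear
    factor of \<open>e\<close> leaves \<open>es\<close> as the roots belonging to the lower block,
    to which the induction hypothesis applies.\<close>
  have "similar_mat_wit B A (mat_adjoint W) W"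
    by (rule similar_mat_witI[of _ _ n]) (use W' A B in \<open>auto simp: B_def\<close>)
  then have "char_poly B = char_poly A" by (intro char_poly_similar) (auto simp: similar_mat_def)
  also have "char_poly B = char_poly (mat 1 1 (\<lambda>_. e)) * char_poly A3"
    unfolding Bblock by (rule char_poly_four_block_zeros_col[OF _ A2 A3]) simp
  also have "char_poly (mat 1 1 (\<lambda>_. e)) = [:- e, 1:]"
    by (simp add: char_poly_defs det_def sign_def)
  finally have "char_poly A3 = (\<Prod>e\<leftarrow>es. [:- e, 1:])"
    unfolding cp by (metis mult_cancel_left pCons_eq_0_iff zero_neq_one)
  from Cons.IH[OF A3 this] obtain V3 where V3: "V3 \<in> unitary_group m"
    and d3: "diag_mat (mat_adjoint V3 * A3 * V3) = es" by auto
  note V3' = unitary_groupD[OF V3]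
  define Q where "Q = four_block_mat (1\<^sub>m 1) (0\<^sub>m 1 m) (0\<^sub>m m 1) V3"
  have Q: "Q \<in> unitary_group n" using block_diag_unitary[OF V3] unfolding Q_def n .
  note Q' = unitary_groupD[OF Q]
  have adj: "mat_adjoint Q = four_block_mat (1\<^sub>m 1) (0\<^sub>m 1 m) (0\<^sub>m m 1) (mat_adjoint V3)"
    using V3' unfolding Q_def by (intro eq_matI) auto
  have "mat_adjoint (W * Q) * A * (W * Q) = mat_adjoint Q * (mat_adjoint W * A * W) * Q"
    using W'(1) Q'(1) A
    by (simp add: mat_adjoint_mult[of W n n Q n] assoc_mult_mat[of _ n n _ n _ n])
  also have "\<dots> = four_block_mat (1\<^sub>m 1) (0\<^sub>m 1 m) (0\<^sub>m m 1) (mat_adjoint V3)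
      * four_block_mat (mat 1 1 (\<lambda>_. e)) A2 (0\<^sub>m m 1) A3 * Q"
    by (simp only: adj Bblock[symmetric] B_def[symmetric])
  also have "\<dots> = four_block_mat (mat 1 1 (\<lambda>_. e)) A2 (0\<^sub>m m 1) (mat_adjoint V3 * A3) * Q"
    using V3'(1) A2 A3 by (subst mult_four_block_mat[of _ 1 1 _ m _ m _ _ 1 _ m]) auto
  also have "\<dots> = four_block_mat (mat 1 1 (\<lambda>_. e)) (A2 * V3) (0\<^sub>m m 1) (mat_adjoint V3 * A3 * V3)"
    unfolding Q_def using V3'(1) A2 A3 by (subst mult_four_block_mat[of _ 1 1 _ m _ m _ _ 1 _ m]) auto
  also have "diag_mat \<dots> = diag_mat (mat 1 1 (\<lambda>_. e)) @ diag_mat (mat_adjoint V3 * A3 * V3)"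
    using V3'(1) A3 by (intro diag_four_block_mat[of _ 1 _ m]) auto
  also note d3
  also have "diag_mat (mat 1 1 (\<lambda>_. e)) @ es = e # es" by (simp add: diag_mat_def)
  finally show ?case using unitary_group_mult[OF W Q] by blast
qed

section \<open>The trace norm: duality and pure states\<close>

lemma proots_char_poly:
  fixes A :: "complex mat"
  assumes "char_poly A = (\<Prod>e\<leftarrow>es. [:- e, 1:])"
  shows "proots (char_poly A) = mset es"
proof -
  have "proots (\<Prod>e\<leftarrow>es. [:- e, 1:]) = mset es" for es :: "complex list"
  proof (induction es)
    case (Cons e es)
    have "(\<Prod>e\<leftarrow>es. [:- e, 1:]) \<noteq> 0" by (auto simp: prod_list_zero_iff)
    then have "proots ([:- e, 1:] * (\<Prod>e\<leftarrow>es. [:- e, 1:])) = proots [:- e, 1:] + proots (\<Prod>e\<leftarrow>es. [:- e, 1:])"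
      by (intro proots_mult) auto
    with Cons show ?case by simp
  qed simp
  then show ?thesis using assms by simp
qed

text \<open>If \<open>V\<close> triangularises \<open>A\<^sup>\<dagger> A\<close>, the diagonal entries of the triangular form are the squared norms
  of the columns of \<open>A V\<close>.\<close>

lemma trace_norm_eq_column_norms:
  assumes A: "A \<in> carrier_mat n n"
  obtains V where "V \<in> unitary_group n"
    "trace_norm A = (\<Sum>i<n. sqrt (\<Sum>l<n. (cmod ((A * V) $$ (l, i)))\<^sup>2))"
proof -
  have AA: "mat_adjoint A * A \<in> carrier_mat n n" using A by auto
  obtain es where es: "char_poly (mat_adjoint A * A) = (\<Prod>e\<leftarrow>es. [:- e, 1:])"
    using char_poly_factorized[OF AA] by auto
  from unitary_triangularisation[OF AA es] obtain V where V: "V \<in> unitary_group n"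
    and d: "diag_mat (mat_adjoint V * (mat_adjoint A * A) * V) = es" by auto
  note V' = unitary_groupD[OF V]
  let ?T = "mat_adjoint V * (mat_adjoint A * A) * V"
  have T: "?T $$ (i, i) = complex_of_real (\<Sum>l<n. (cmod ((A * V) $$ (l, i)))\<^sup>2)" if "i < n" for i
  proof -
    have "?T = mat_adjoint (A * V) * (A * V)"
      using A V'(1) by (simp add: mat_adjoint_mult[of A n n V n] assoc_mult_mat[of _ n n _ n _ n])
    moreover have "A * V \<in> carrier_mat n n" using A V'(1) by simp
    ultimately show ?thesis using that A V'(1)
      by (simp add: index_mult_mat_sum[of _ n n "A * V" n] complex_norm_square mult.commute
          del: index_mult_mat(1) of_real_power)
  qed
  have "trace_norm A = (\<Sum>x\<leftarrow>es. sqrt (Re x))"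
    unfolding trace_norm_def proots_char_poly[OF es] by (simp flip: sum_mset_sum_list)
  also have "\<dots> = (\<Sum>i<n. sqrt (Re (?T $$ (i, i))))"
    using V'(1) unfolding d[symmetric] diag_mat_def
    by (simp add: sum_list_sum_nth atLeast0LessThan del: index_mult_mat(1))
  also have "\<dots> = (\<Sum>i<n. sqrt (\<Sum>l<n. (cmod ((A * V) $$ (l, i)))\<^sup>2))"
    by (intro sum.cong refl) (simp only: T lessThan_iff Re_complex_of_real)
  finally show ?thesis using that V by blast
qed

text \<open>Inserting \<open>V * mat_adjoint V\<close> and using cyclicity, the trace becomes a sum
  over \<open>i\<close> of row \<open>i\<close> of the unitary \<open>N\<close> times column
  \<open>i\<close> of \<open>A * V\<close>. Cauchy-Schwarz with unit rows leaves the column norms,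
  whose sum is the trace norm.\<close>

lemma trace_norm_duality:
  assumes A: "A \<in> carrier_mat n n" and M: "M \<in> unitary_group n"
  shows "cmod (mat_trace (M * A)) \<le> trace_norm A"
proof -
  obtain V where V: "V \<in> unitary_group n"
    and tn: "trace_norm A = (\<Sum>i<n. sqrt (\<Sum>l<n. (cmod ((A * V) $$ (l, i)))\<^sup>2))"
    using trace_norm_eq_column_norms[OF A] .
  note V' = unitary_groupD[OF V] and M' = unitary_groupD[OF M]
  define N where "N = mat_adjoint V * M"
  have N: "N \<in> unitary_group n" unfolding N_def by (intro unitary_group_mult unitary_group_adjoint M V)
  note N' = unitary_groupD[OF N]
  have AV: "A * V \<in> carrier_mat n n" using A V' by simp
  have "mat_trace (M * A) = mat_trace (M * A * (V * mat_adjoint V))"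
    using A M' V' by simp
  also have "\<dots> = mat_trace (M * (A * V) * mat_adjoint V)"
    using A M'(1) V'(1) by (simp add: assoc_mult_mat[of _ n n _ n _ n])
  also have "\<dots> = mat_trace (mat_adjoint V * (M * (A * V)))"
    using A M'(1) V'(1) by (intro mat_trace_mult_comm[of _ n n]) auto
  also have "mat_adjoint V * (M * (A * V)) = N * (A * V)"
    using A M'(1) V'(1) by (simp add: N_def assoc_mult_mat[of _ n n _ n _ n])
  also have "mat_trace (N * (A * V)) = (\<Sum>i<n. \<Sum>l<n. N $$ (i, l) * (A * V) $$ (l, i))"
    using N'(1) AV by (simp add: mat_trace_def index_mult_mat_sum[of N n n _ n] del: index_mult_mat(1))
  also have "cmod \<dots> \<le> (\<Sum>i<n. \<Sum>l<n. cmod (N $$ (i, l)) * cmod ((A * V) $$ (l, i)))"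
    by (intro sum_norm_le order.trans[OF sum_norm_le] order.refl) (auto simp: norm_mult)
  also have "\<dots> \<le> (\<Sum>i<n. sqrt (\<Sum>l<n. (cmod ((A * V) $$ (l, i)))\<^sup>2))"
  proof (rule sum_mono)
    fix i assume "i \<in> {..<n}"
    then have i: "i < n" by simp
    have "(\<Sum>l<n. cmod (N $$ (i, l)) * cmod ((A * V) $$ (l, i))) \<le>
        L2_set (\<lambda>l. cmod (N $$ (i, l))) {..<n} * L2_set (\<lambda>l. cmod ((A * V) $$ (l, i))) {..<n}"
      using L2_set_mult_ineq[of "\<lambda>l. cmod (N $$ (i, l))" "\<lambda>l. cmod ((A * V) $$ (l, i))" "{..<n}"] by simp
    also have "L2_set (\<lambda>l. cmod (N $$ (i, l))) {..<n} = 1"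
      unfolding L2_set_def using unitary_row_norm[OF N i] by simp
    finally show "(\<Sum>l<n. cmod (N $$ (i, l)) * cmod ((A * V) $$ (l, i)))
        \<le> sqrt (\<Sum>l<n. (cmod ((A * V) $$ (l, i)))\<^sup>2)"
      by (simp add: L2_set_def)
  qed
  finally show ?thesis unfolding tn .
qed

lemma eigenvalue_idempotent:
  fixes A :: "complex mat"
  assumes A: "A \<in> carrier_mat n n" "A * A = A" and e: "eigenvalue A e"
  shows "e = 0 \<or> e = 1"
proof -
  obtain v where v: "v \<in> carrier_vec n" "v \<noteq> 0\<^sub>v n" "A *\<^sub>v v = e \<cdot>\<^sub>v v"
    using e A(1) unfolding eigenvalue_def eigenvector_def by auto
  have "A *\<^sub>v (A *\<^sub>v v) = A *\<^sub>v v"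
    using A v(1) by (metis assoc_mult_mat_vec)
  then have eq: "e \<cdot>\<^sub>v (e \<cdot>\<^sub>v v) = e \<cdot>\<^sub>v v"
    using A(1) v by (simp add: mult_mat_vec)
  obtain i where i: "i < n" "v $ i \<noteq> 0"
  proof (rule ccontr)
    assume "\<not> thesis"
    then have "v = 0\<^sub>v n" using that v(1) by (intro eq_vecI) auto
    then show False using v(2) by simp
  qed
  have "(e \<cdot>\<^sub>v (e \<cdot>\<^sub>v v)) $ i = (e \<cdot>\<^sub>v v) $ i" by (simp only: eq)
  then have "e * (e * v $ i) = e * v $ i" using i v(1) by simp
  then show ?thesis using i(2) by auto
qed

text \<open>Here \<open>mat_adjoint A * A\<close> is \<open>A\<close> itself, with eigenvalues
  \<open>0\<close> and \<open>1\<close>. These are fixed by the square root, so the singular values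
  add up to the trace.\<close>

lemma trace_norm_projection:
  fixes A :: "complex mat"
  assumes A: "A \<in> carrier_mat n n" "A * A = A" "mat_adjoint A = A"
  shows "trace_norm A = Re (mat_trace A)"
proof -
  obtain es where es: "char_poly A = (\<Prod>e\<leftarrow>es. [:- e, 1:])"
    using char_poly_factorized[OF A(1)] by auto
  from unitary_triangularisation[OF A(1) es] obtain V where V: "V \<in> unitary_group n"
    and d: "diag_mat (mat_adjoint V * A * V) = es" by auto
  note V' = unitary_groupD[OF V]
  have e01: "sqrt (Re e) = Re e" if "e \<in> set es" for e
  proof -
    have "poly (char_poly A) e = 0" unfolding es using that by (rule linear_poly_root)
    then have "eigenvalue A e" using eigenvalue_root_char_poly[OF A(1)] by simp
    from eigenvalue_idempotent[OF A(1,2) this] show ?thesis by auto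
  qed
  have "trace_norm A = (\<Sum>x\<leftarrow>es. sqrt (Re x))"
    unfolding trace_norm_def A(2,3) proots_char_poly[OF es] by (simp flip: sum_mset_sum_list)
  also have "\<dots> = (\<Sum>x\<leftarrow>es. Re x)" using e01 by (intro arg_cong[of _ _ sum_list] map_cong refl)
  also have "\<dots> = (\<Sum>i<n. Re ((mat_adjoint V * A * V) $$ (i, i)))"
    using V'(1) unfolding d[symmetric] diag_mat_def
    by (simp add: sum_list_sum_nth atLeast0LessThan del: index_mult_mat(1))
  also have "\<dots> = Re (mat_trace (mat_adjoint V * A * V))"
    using V'(1) by (simp add: mat_trace_def del: index_mult_mat(1))
  also have "mat_trace (mat_adjoint V * A * V) = mat_trace (V * (mat_adjoint V * A))"
    using V'(1) A(1) by (intro mat_trace_mult_comm[of _ n n]) auto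
  also have "V * (mat_adjoint V * A) = V * mat_adjoint V * A"
    using V'(1) A(1) by (intro assoc_mult_mat[symmetric, of _ n n _ n _ n]) auto
  also have "\<dots> = A" using V'(3) A(1) by simp
  finally show ?thesis .
qed

text \<open>Makes pure states admissible in the supremum that defines the diamond norm: the matrix
  is the orthogonal projection onto the unit vector \<psi>.\<close>

lemma trace_norm_rank_one:
  assumes "(\<Sum>i<n. (cmod (\<psi> i))\<^sup>2) = 1"
  shows "trace_norm (mat n n (\<lambda>(i, j). \<psi> i * cnj (\<psi> j))) = 1"
proof -
  let ?A = "mat n n (\<lambda>(i, j). \<psi> i * cnj (\<psi> j))"
  have one: "(\<Sum>i<n. \<psi> i * cnj (\<psi> i)) = 1"
  proof -
    have "(\<Sum>i<n. \<psi> i * cnj (\<psi> i)) = complex_of_real (\<Sum>i<n. (cmod (\<psi> i))\<^sup>2)"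
      by (simp only: of_real_sum complex_norm_square)
    then show ?thesis using assms by simp
  qed
  have A: "?A \<in> carrier_mat n n" by simp
  have "?A * ?A = ?A"
  proof (rule eq_matI)
    fix i j assume "i < dim_row ?A" "j < dim_col ?A"
    then have ij: "i < n" "j < n" by auto
    have "(?A * ?A) $$ (i, j) = (\<Sum>k<n. \<psi> i * cnj (\<psi> j) * (\<psi> k * cnj (\<psi> k)))"
      using ij by (simp add: index_mult_mat_sum[OF A A] mult_ac del: index_mult_mat)
    also have "\<dots> = \<psi> i * cnj (\<psi> j)" by (simp add: one flip: sum_distrib_left)
    finally show "(?A * ?A) $$ (i, j) = ?A $$ (i, j)" using ij by simp
  qed auto
  moreover have "mat_adjoint ?A = ?A" by (rule eq_matI) (auto simp: mult.commute)
  ultimately have "trace_norm ?A = Re (mat_trace ?A)" by (intro trace_norm_projection[OF A])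
  then show ?thesis using one by (simp add: mat_trace_def)
qed

text \<open>The permutation matrix of an involution is self-adjoint and squares to the identity,
  hence is a unitary to which duality applies. A product of Pauli matrices X is such a matrix, and
  the sum is its expectation in \<open>Y\<close>.\<close>

lemma trace_norm_involution:
  assumes Y: "Y \<in> carrier_mat n n"
    and \<pi>: "\<And>i. i < n \<Longrightarrow> \<pi> i < n" "\<And>i. i < n \<Longrightarrow> \<pi> (\<pi> i) = i"
  shows "cmod (\<Sum>i<n. Y $$ (\<pi> i, i)) \<le> trace_norm Y"
proof -
  define M where "M = (mat n n (\<lambda>(i, j). if j = \<pi> i then 1 else 0) :: complex mat)"
  have M: "M \<in> carrier_mat n n" by (simp add: M_def)
  have ent: "M $$ (i, j) = (if j = \<pi> i then 1 else 0)" if "i < n" "j < n" for i j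
    using that by (simp add: M_def)
  have "mat_adjoint M = M"
  proof (rule eq_matI)
    fix i j assume "i < dim_row M" "j < dim_col M"
    then have ij: "i < n" "j < n" using M by auto
    have "i = \<pi> j \<longleftrightarrow> j = \<pi> i" using \<pi> ij by metis
    then show "mat_adjoint M $$ (i, j) = M $$ (i, j)" using M ij by (simp add: ent)
  qed (use M in auto)
  moreover have "M * M = 1\<^sub>m n"
  proof (rule eq_matI)
    fix i j assume "i < dim_row (1\<^sub>m n :: complex mat)" "j < dim_col (1\<^sub>m n :: complex mat)"
    then have ij: "i < n" "j < n" by auto
    have "(M * M) $$ (i, j) = (\<Sum>k<n. M $$ (i, k) * M $$ (k, j))"
      by (rule index_mult_mat_sum[OF M M ij])
    also have "\<dots> = (\<Sum>k<n. if k = \<pi> i then M $$ (\<pi> i, j) else 0)"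
      using ij by (intro sum.cong refl) (simp add: ent)
    also have "\<dots> = 1\<^sub>m n $$ (i, j)" using ij \<pi> by (simp add: ent)
    finally show "(M * M) $$ (i, j) = 1\<^sub>m n $$ (i, j)" .
  qed (use M in auto)
  ultimately have "M \<in> unitary_group n" using M by (simp add: unitary_group_def)
  then have "cmod (mat_trace (M * Y)) \<le> trace_norm Y" by (rule trace_norm_duality[OF Y])
  moreover have "mat_trace (M * Y) = (\<Sum>i<n. \<Sum>k<n. M $$ (i, k) * Y $$ (k, i))"
    using M by (simp add: mat_trace_def index_mult_mat_sum[OF M Y] del: index_mult_mat(1))
  moreover have "\<dots> = (\<Sum>i<n. \<Sum>k<n. if k = \<pi> i then Y $$ (\<pi> i, i) else 0)"
    by (intro sum.cong refl) (simp add: ent)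
  ultimately show ?thesis using \<pi> by simp
qed

section \<open>Locality and lightcones\<close>

lemma bit_imp_less:
  fixes x :: nat
  assumes "bit x q" "x < 2 ^ n"
  shows "q < n"
proof -
  have "take_bit n x = x" using assms(2) by (simp add: take_bit_nat_eq_self_iff)
  then have "bit (take_bit n x) q" using assms(1) by simp
  then show ?thesis by (simp add: bit_take_bit_iff)
qed

lemma less_power2I:
  assumes "\<And>q. bit x q \<Longrightarrow> q < n"
  shows "(x :: nat) < 2 ^ n"
proof -
  have "take_bit n x = x" by (rule bit_eqI) (use assms in \<open>auto simp: bit_take_bit_iff\<close>)
  then show ?thesis by (simp add: take_bit_nat_eq_self_iff)
qed

lemma nat_bit_eqI:
  fixes x y :: nat
  assumes "x < 2 ^ n" "y < 2 ^ n" "\<And>q. q < n \<Longrightarrow> bit x q = bit y q"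
  shows "x = y"
  by (rule bit_eqI) (use assms bit_imp_less in blast)

lemma bit_flip [simp]: "bit (flip_bit q x) p \<longleftrightarrow> bit x p \<noteq> (p = q)" for x :: nat
  by (auto simp: bit_flip_bit_iff)

lemma flip_bit_less [simp]: "q < n \<Longrightarrow> x < 2 ^ n \<Longrightarrow> flip_bit q x < (2 ^ n :: nat)"
  by (rule less_power2I) (auto dest: bit_imp_less split: if_splits)

lemma flip_bit_flip_bit [simp]: "flip_bit q (flip_bit q x) = (x :: nat)"
  by (rule bit_eqI) auto

lemma flip_bit_neq [simp]: "flip_bit q x \<noteq> (x :: nat)"
proof
  assume "flip_bit q x = x"
  then have "bit (flip_bit q x) q = bit x q" by simp
  then show False by simp
qed

lemma flip_bit_bij: "q < n \<Longrightarrow> bij_betw (flip_bit q) {..<2 ^ n} {..<2 ^ n :: nat}"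
  by (rule bij_betwI[of _ _ _ "flip_bit q"]) auto

definition merge_bits :: "nat \<Rightarrow> nat set \<Rightarrow> nat \<Rightarrow> nat \<Rightarrow> nat" where
  "merge_bits n S x y = set_encode {q. q < n \<and> bit (if q \<in> S then x else y) q}"

lemma bit_merge_bits [simp]:
  "bit (merge_bits n S x y) q \<longleftrightarrow> q < n \<and> (if q \<in> S then bit x q else bit y q)"
proof -
  have "bit m q \<longleftrightarrow> q \<in> set_decode m" for m :: nat
    by (simp add: set_decode_def bit_nat_def)
  then show ?thesis by (simp add: merge_bits_def)
qed

lemma merge_bits_less [simp]: "merge_bits n S x y < 2 ^ n"
  by (rule less_power2I) auto

text \<open>Invariance under conjugation by the Pauli matrices \<open>X\<close> and \<open>Z\<close> of every qubit outside \<open>S\<close>,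
  spelled out in matrix entries. Unlike the form \<open>g \<otimes> 1\<close>, this is evidently closed under products.\<close>

definition local_on :: "nat \<Rightarrow> nat set \<Rightarrow> complex mat \<Rightarrow> bool" where
  "local_on n S A \<longleftrightarrow> (\<forall>q<n. q \<notin> S \<longrightarrow> (\<forall>x<2 ^ n. \<forall>y<2 ^ n.
     A $$ (flip_bit q x, flip_bit q y) = A $$ (x, y) \<and> (bit x q \<noteq> bit y q \<longrightarrow> A $$ (x, y) = 0)))"

lemma local_on_flip:
  assumes "local_on n S A" "q < n" "q \<notin> S" "x < 2 ^ n" "y < 2 ^ n"
  shows "A $$ (flip_bit q x, flip_bit q y) = A $$ (x, y)"
  using assms unfolding local_on_def by auto

lemma local_on_zero:
  assumes "local_on n S A" "q < n" "q \<notin> S" "x < 2 ^ n" "y < 2 ^ n" "bit x q \<noteq> bit y q"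
  shows "A $$ (x, y) = 0"
  using assms unfolding local_on_def by auto

lemma local_on_mono: "local_on n S A \<Longrightarrow> S \<subseteq> T \<Longrightarrow> local_on n T A"
  unfolding local_on_def by blast

lemma local_on_mult:
  assumes A: "A \<in> carrier_mat (2 ^ n) (2 ^ n)" "local_on n S A"
    and B: "B \<in> carrier_mat (2 ^ n) (2 ^ n)" "local_on n S B"
  shows "local_on n S (A * B)"
  unfolding local_on_def
proof (intro allI impI conjI)
  fix q x y :: nat assume q: "q < n" "q \<notin> S" and xy: "x < 2 ^ n" "y < 2 ^ n"
  have "(A * B) $$ (flip_bit q x, flip_bit q y) =
      (\<Sum>z<2^n. A $$ (flip_bit q x, z) * B $$ (z, flip_bit q y))"
    using A(1) B(1) q xy by (intro index_mult_mat_sum) auto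
  also have "\<dots> = (\<Sum>z<2^n. A $$ (flip_bit q x, flip_bit q z) * B $$ (flip_bit q z, flip_bit q y))"
    by (rule sum.reindex_bij_betw[OF flip_bit_bij[OF q(1)], symmetric])
  also have "\<dots> = (\<Sum>z<2^n. A $$ (x, z) * B $$ (z, y))"
    using q xy by (intro sum.cong refl) (simp add: local_on_flip[OF A(2)] local_on_flip[OF B(2)])
  also have "\<dots> = (A * B) $$ (x, y)"
    using A(1) B(1) xy by (intro index_mult_mat_sum[symmetric]) auto
  finally show "(A * B) $$ (flip_bit q x, flip_bit q y) = (A * B) $$ (x, y)" .
  assume bit: "bit x q \<noteq> bit y q"
  have "(A * B) $$ (x, y) = (\<Sum>z<2^n. A $$ (x, z) * B $$ (z, y))"
    using A(1) B(1) xy by (intro index_mult_mat_sum) auto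
  also have "\<dots> = 0"
  proof (intro sum.neutral ballI)
    fix z :: nat assume "z \<in> {..<2^n}"
    then have z: "z < 2 ^ n" by simp
    show "A $$ (x, z) * B $$ (z, y) = 0"
      using local_on_zero[OF A(2) q xy(1) z] local_on_zero[OF B(2) q z xy(2)] bit
      by (cases "bit z q = bit x q") auto
  qed
  finally show "(A * B) $$ (x, y) = 0" .
qed

lemma local_on_adjoint:
  assumes A: "A \<in> carrier_mat (2 ^ n) (2 ^ n)" "local_on n S A"
  shows "local_on n S (mat_adjoint A)"
  unfolding local_on_def
proof (intro allI impI conjI)
  fix q x y :: nat assume q: "q < n" "q \<notin> S" and xy: "x < 2 ^ n" "y < 2 ^ n"
  show "mat_adjoint A $$ (flip_bit q x, flip_bit q y) = mat_adjoint A $$ (x, y)"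
    using A(1) q xy local_on_flip[OF A(2) q xy(2,1)] by simp
  assume "bit x q \<noteq> bit y q"
  then show "mat_adjoint A $$ (x, y) = 0"
    using A(1) xy local_on_zero[OF A(2) q xy(2,1)] by simp
qed

lemma acts_on_local:
  assumes "acts_on n S U"
  shows "local_on n S U"
proof -
  obtain g where g: "\<And>x y. x < 2 ^ n \<Longrightarrow> y < 2 ^ n \<Longrightarrow> U $$ (x, y) =
          (if \<forall>q\<in>{..<n} - S. bit x q = bit y q then g {q \<in> S. bit x q} {q \<in> S. bit y q} else 0)"
    using assms unfolding acts_on_def by blast
  show ?thesis unfolding local_on_def
  proof (intro allI impI conjI)
    fix q x y :: nat assume q: "q < n" "q \<notin> S" and xy: "x < 2 ^ n" "y < 2 ^ n"
    have "{p \<in> S. bit (flip_bit q z) p} = {p \<in> S. bit z p}" for z :: nat using q by auto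
    moreover have "(\<forall>p\<in>{..<n} - S. bit (flip_bit q x) p = bit (flip_bit q y) p)
        \<longleftrightarrow> (\<forall>p\<in>{..<n} - S. bit x p = bit y p)" by auto
    ultimately show "U $$ (flip_bit q x, flip_bit q y) = U $$ (x, y)"
      using q xy by (simp only: g flip_bit_less)
    assume "bit x q \<noteq> bit y q"
    then show "U $$ (x, y) = 0" using g[OF xy] q by auto
  qed
qed

text \<open>As \<open>x\<close> and \<open>y\<close> agree on \<open>s\<close>, overwriting a bit in
  \<open>s\<close> flips it either in both or in neither. Each such flip is outside \<open>S\<close>
  and leaves the entry unchanged, so the bits in \<open>s\<close> can be replaced one at a
  time.\<close>

lemma local_on_merge:
  assumes A: "local_on n S A" and x: "x < 2 ^ n" "y < 2 ^ n" and s: "finite s" "s \<inter> S = {}"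
    and eq: "\<And>q. q \<in> s \<Longrightarrow> bit x q = bit y q"
  shows "A $$ (merge_bits n s w x, merge_bits n s w y) = A $$ (x, y)"
  using s eq
proof (induction s)
  case empty
  have "merge_bits n {} w z = z" if "z < 2 ^ n" for z
    by (rule bit_eqI) (use that in \<open>auto dest: bit_imp_less\<close>)
  then show ?case using x by simp
next
  case (insert q s)
  then have IH: "A $$ (merge_bits n s w x, merge_bits n s w y) = A $$ (x, y)" by auto
  have bq: "bit x q = bit y q" using insert.prems by auto
  show ?case
  proof (cases "q < n \<and> bit x q \<noteq> bit w q")
    case True
    have "merge_bits n (insert q s) w z = flip_bit q (merge_bits n s w z)" if "bit z q = bit x q" for z
      by (rule bit_eqI) (use True insert.hyps that in auto)
    then show ?thesis using IH bq True insert.prems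
      by (simp add: local_on_flip[OF A])
  next
    case False
    have "merge_bits n (insert q s) w z = merge_bits n s w z" if "bit z q = bit x q" for z
      by (rule bit_eqI) (use False insert.hyps that in auto)
    then show ?thesis using IH bq by simp
  qed
qed

text \<open>\<open>A\<close> cannot change bits in \<open>s\<close> and \<open>U\<close> cannot
  change bits outside \<open>s\<close>. So each matrix product has at most one nonzero term per
  entry: the intermediate state takes every bit from \<open>x\<close> or from \<open>y\<close>, with
  opposite choices in the two orders.\<close>

lemma disjoint_commute:
  assumes A: "A \<in> carrier_mat (2 ^ n) (2 ^ n)" "local_on n S A"
    and U: "U \<in> carrier_mat (2 ^ n) (2 ^ n)" "acts_on n s U"
    and s: "s \<subseteq> {..<n}" "s \<inter> S = {}"
  shows "A * U = U * A"
proof (rule eq_matI)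
  fix x y assume "x < dim_row (U * A)" "y < dim_col (U * A)"
  then have xy: "x < 2 ^ n" "y < 2 ^ n" using A(1) U(1) by auto
  obtain g where g: "\<And>x y. x < 2 ^ n \<Longrightarrow> y < 2 ^ n \<Longrightarrow> U $$ (x, y) =
          (if \<forall>q\<in>{..<n} - s. bit x q = bit y q then g {q \<in> s. bit x q} {q \<in> s. bit y q} else 0)"
    using U(2) unfolding acts_on_def by blast
  have sn: "q < n" if "q \<in> s" for q using s(1) that by auto
  define z0 where "z0 = merge_bits n s x y"
  define z1 where "z1 = merge_bits n s y x"
  have z: "z0 < 2 ^ n" "z1 < 2 ^ n" by (simp_all add: z0_def z1_def)
  have "(A * U) $$ (x, y) = (\<Sum>z<2^n. A $$ (x, z) * U $$ (z, y))"
    using A(1) U(1) xy by (intro index_mult_mat_sum) auto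
  also have "\<dots> = (\<Sum>z\<in>{z0}. A $$ (x, z) * U $$ (z, y))"
  proof (rule sum.mono_neutral_right)
    show "\<forall>z\<in>{..<2 ^ n} - {z0}. A $$ (x, z) * U $$ (z, y) = 0"
    proof (rule ballI, rule ccontr)
      fix z assume "z \<in> {..<2 ^ n} - {z0}" and nz: "A $$ (x, z) * U $$ (z, y) \<noteq> 0"
      then have zz: "z < 2 ^ n" "z \<noteq> z0" by auto
      have "bit z q = bit y q" if "q < n" "q \<notin> s" for q
        using nz g[OF zz(1) xy(2)] that by (auto split: if_splits)
      moreover have "bit z q = bit x q" if "q \<in> s" for q
        using nz local_on_zero[OF A(2) _ _ xy(1) zz(1), of q] that s by auto
      ultimately have "z = z0"
        by (intro nat_bit_eqI[OF zz(1) z(1)]) (simp add: z0_def)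
      with zz show False by simp
    qed
  qed (use z in auto)
  finally have 1: "(A * U) $$ (x, y) = A $$ (x, z0) * U $$ (z0, y)" by simp
  have "(U * A) $$ (x, y) = (\<Sum>z<2^n. U $$ (x, z) * A $$ (z, y))"
    using A(1) U(1) xy by (intro index_mult_mat_sum) auto
  also have "\<dots> = (\<Sum>z\<in>{z1}. U $$ (x, z) * A $$ (z, y))"
  proof (rule sum.mono_neutral_right)
    show "\<forall>z\<in>{..<2 ^ n} - {z1}. U $$ (x, z) * A $$ (z, y) = 0"
    proof (rule ballI, rule ccontr)
      fix z assume "z \<in> {..<2 ^ n} - {z1}" and nz: "U $$ (x, z) * A $$ (z, y) \<noteq> 0"
      then have zz: "z < 2 ^ n" "z \<noteq> z1" by auto
      have "bit z q = bit x q" if "q < n" "q \<notin> s" for q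
        using nz g[OF xy(1) zz(1)] that by (auto split: if_splits)
      moreover have "bit z q = bit y q" if "q \<in> s" for q
        using nz local_on_zero[OF A(2) _ _ zz(1) xy(2), of q] that s by auto
      ultimately have "z = z1"
        by (intro nat_bit_eqI[OF zz(1) z(2)]) (simp add: z1_def)
      with zz show False by simp
    qed
  qed (use z in auto)
  finally have 2: "(U * A) $$ (x, y) = U $$ (x, z1) * A $$ (z1, y)" by simp
  \<comment> \<open>\<open>x\<close> and \<open>z0\<close> agree on \<open>s\<close>; overwriting
    these bits by those of \<open>y\<close> turns the pair \<open>(x, z0)\<close> into
    \<open>(z1, y)\<close>. The entries of \<open>U\<close> agree because \<open>g\<close> only sees
    the bits in \<open>s\<close>.\<close>
  have "merge_bits n s y z0 = y"
    by (rule bit_eqI) (use xy bit_imp_less in \<open>auto simp: z0_def\<close>)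
  then have 3: "A $$ (x, z0) = A $$ (z1, y)"
    using local_on_merge[OF A(2) xy(1) z(1) _ s(2), of y] finite_subset[OF s(1)] sn
    by (simp add: z0_def z1_def)
  have "{q \<in> s. bit z0 q} = {q \<in> s. bit x q}" "{q \<in> s. bit z1 q} = {q \<in> s. bit y q}"
    using s by (auto simp: z0_def z1_def)
  moreover have "\<forall>q\<in>{..<n} - s. bit z0 q = bit y q" "\<forall>q\<in>{..<n} - s. bit x q = bit z1 q"
    by (auto simp: z0_def z1_def)
  ultimately have "U $$ (z0, y) = U $$ (x, z1)"
    unfolding g[OF z(1) xy(2)] g[OF xy(1) z(2)] by simp
  then show "(A * U) $$ (x, y) = (U * A) $$ (x, y)" unfolding 1 2 3 by simp
qed (use A(1) U(1) in auto)

section \<open>Conjugation by layers and circuits\<close>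

lemma valid_layer_ConsD:
  assumes "valid_layer n r E (g # L)"
  shows "valid_gate n r E g" "valid_layer n r E L" "\<And>h. h \<in> set L \<Longrightarrow> fst g \<inter> fst h = {}"
proof -
  note d = assms[unfolded valid_layer_def, THEN conjunct2, rule_format]
  show "valid_gate n r E g" using assms by (simp add: valid_layer_def)
  show "valid_layer n r E L" unfolding valid_layer_def
  proof (intro conjI allI impI)
    fix i j assume "i < length L" "j < length L" "i \<noteq> j"
    then show "fst (L ! i) \<inter> fst (L ! j) = {}" using d[of "Suc i" "Suc j"] by simp
  qed (use assms in \<open>simp add: valid_layer_def\<close>)
  fix h assume "h \<in> set L"
  then obtain i where "i < length L" "h = L ! i" by (auto simp: in_set_conv_nth)
  then show "fst g \<inter> fst h = {}" using d[of 0 "Suc i"] by simp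
qed

lemma layer_unitary_unitary:
  "valid_layer n r E L \<Longrightarrow> layer_unitary n L \<in> unitary_group (2 ^ n)"
proof (induction L)
  case (Cons g L)
  then show ?case using valid_layer_ConsD[OF Cons.prems]
    by (auto simp: layer_unitary_def valid_gate_def intro!: unitary_group_mult)
qed (simp add: layer_unitary_def unitary_group_one)

lemma circuit_unitary_snoc:
  "circuit_unitary n (C @ [L]) = layer_unitary n L * circuit_unitary n C"
  by (simp add: circuit_unitary_def)

lemma circuit_unitary_unitary:
  "\<forall>L\<in>set C. valid_layer n r E L \<Longrightarrow> circuit_unitary n C \<in> unitary_group (2 ^ n)"
proof (induction C rule: rev_induct)
  case (snoc L C)
  then show ?case unfolding circuit_unitary_snoc
    by (intro unitary_group_mult layer_unitary_unitary) auto
qed (simp add: circuit_unitary_def unitary_group_one)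

lemma conjugate_mult:
  assumes "U \<in> carrier_mat n n" "V \<in> carrier_mat n n" "(A :: complex mat) \<in> carrier_mat n n"
  shows "(U * V) * A * mat_adjoint (U * V) = U * (V * A * mat_adjoint V) * mat_adjoint U"
  using assms by (simp add: mat_adjoint_mult[of U n n V n] assoc_mult_mat[of _ n n _ n _ n])

text \<open>A gate disjoint from \<open>S\<close> is also disjoint from everything that the other
  gates of the layer have added, since supports within a layer are disjoint. It then commutes with
  the operator and cancels against its adjoint. This is why only the gates meeting the original
  \<open>S\<close> enlarge the set.\<close>

lemma local_on_conjugate_layer:
  assumes "valid_layer n r E L" and A: "A \<in> carrier_mat (2 ^ n) (2 ^ n)" "local_on n S A"
  shows "local_on n (S \<union> \<Union>{fst g | g. g \<in> set L \<and> fst g \<inter> S \<noteq> {}})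
    (layer_unitary n L * A * mat_adjoint (layer_unitary n L))"
  using assms(1)
proof (induction L)
  case Nil
  then show ?case using A by (simp add: layer_unitary_def)
next
  case (Cons g L)
  note g = valid_layer_ConsD[OF Cons.prems]
  define s U where "s = fst g" and "U = snd g"
  have U: "U \<in> unitary_group (2 ^ n)" "acts_on n s U" "s \<subseteq> {..<n}"
    using g(1) by (auto simp: valid_gate_def s_def U_def)
  note U' = unitary_groupD[OF U(1)]
  define V where "V = layer_unitary n L"
  have V: "V \<in> carrier_mat (2 ^ n) (2 ^ n)"
    unfolding V_def using unitary_groupD(1)[OF layer_unitary_unitary[OF g(2)]] .
  define T where "T = S \<union> \<Union>{fst g | g. g \<in> set L \<and> fst g \<inter> S \<noteq> {}}"
  define B where "B = V * A * mat_adjoint V"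
  have B: "B \<in> carrier_mat (2 ^ n) (2 ^ n)" "local_on n T B"
    using Cons.IH[OF g(2)] V A by (auto simp: B_def V_def T_def)
  have eq: "layer_unitary n (g # L) * A * mat_adjoint (layer_unitary n (g # L)) = U * B * mat_adjoint U"
    unfolding B_def using conjugate_mult[OF U'(1) V A(1)]
    by (simp add: layer_unitary_def V_def U_def)
  show ?case
  proof (cases "s \<inter> S = {}")
    case True
    then have "s \<inter> T = {}" unfolding T_def s_def using g(3) by blast
    then have "U * B * mat_adjoint U = B * U * mat_adjoint U"
      using disjoint_commute[OF B U'(1) U(2,3)] by simp
    also have "\<dots> = B * (U * mat_adjoint U)"
      using U'(1) B(1) by (simp add: assoc_mult_mat[of _ "2^n" "2^n" _ "2^n" _ "2^n"])
    also have "\<dots> = B" using B U' by simp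
    finally show ?thesis unfolding eq by (rule ssubst) (rule local_on_mono[OF B(2)], auto simp: T_def)
  next
    case False
    have "local_on n (T \<union> s) U" using local_on_mono[OF acts_on_local[OF U(2)]] by blast
    moreover have "local_on n (T \<union> s) B" using local_on_mono[OF B(2)] by blast
    ultimately have "local_on n (T \<union> s) (U * B * mat_adjoint U)"
      using U'(1) B(1) by (intro local_on_mult local_on_adjoint) auto
    then show ?thesis unfolding eq
    proof (rule local_on_mono)
      have "s \<subseteq> \<Union>{fst h | h. h \<in> set (g # L) \<and> fst h \<inter> S \<noteq> {}}"
        using False unfolding s_def by (intro Union_upper CollectI exI[of _ g]) auto
      then show "T \<union> s \<subseteq> S \<union> \<Union>{fst h | h. h \<in> set (g # L) \<and> fst h \<inter> S \<noteq> {}}"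
        unfolding T_def by auto
    qed
  qed
qed

lemma lightcone_snoc:
  "lightcone q (C @ [L]) = lightcone q C \<union> \<Union>{fst g | g. g \<in> set L \<and> fst g \<inter> lightcone q C \<noteq> {}}"
  by (simp add: lightcone_def)

text \<open>With the circuit on the left and its adjoint on the right, later layers are the outer
  factors, so the set grows in the same order of layers as in \<open>lightcone\<close>.\<close>

lemma local_on_lightcone:
  assumes "\<forall>L\<in>set C. valid_layer n r E L" and A: "A \<in> carrier_mat (2 ^ n) (2 ^ n)" "local_on n {q} A"
  shows "local_on n (lightcone q C) (circuit_unitary n C * A * mat_adjoint (circuit_unitary n C))"
  using assms(1)
proof (induction C rule: rev_induct)
  case Nil
  then show ?case using A by (simp add: circuit_unitary_def lightcone_def)
next
  case (snoc L C)
  let ?U = "circuit_unitary n C" and ?V = "layer_unitary n L"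
  have U: "?U \<in> carrier_mat (2 ^ n) (2 ^ n)" and V: "?V \<in> carrier_mat (2 ^ n) (2 ^ n)"
    using snoc.prems unitary_groupD(1)[OF circuit_unitary_unitary[of C n r E]]
      unitary_groupD(1)[OF layer_unitary_unitary[of n r E L]] by auto
  have "local_on n (lightcone q (C @ [L])) (?V * (?U * A * mat_adjoint ?U) * mat_adjoint ?V)"
    unfolding lightcone_snoc
    by (rule local_on_conjugate_layer[of n r E]) (use snoc U V A in auto)
  then show ?case unfolding circuit_unitary_snoc conjugate_mult[OF V U A(1)] .
qed

section \<open>Growth of lightcones and the resulting depth bounds\<close>

lemma valid_gateD:
  assumes "valid_gate n r E g"
  shows "fst g \<subseteq> {..<n}" "finite (fst g)" "card (fst g) \<le> r" "connected_in E (fst g)"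
  using assms by (auto simp: valid_gate_def intro: finite_subset split: prod.splits)

lemma lightcone_subset:
  assumes "\<forall>L\<in>set C. valid_layer n r E L" "q < n"
  shows "lightcone q C \<subseteq> {..<n}"
  using assms(1)
proof (induction C rule: rev_induct)
  case (snoc L C)
  have "fst g \<subseteq> {..<n}" if "g \<in> set L" for g
    using snoc.prems that valid_gateD(1)[of n r E g] by (auto simp: valid_layer_def)
  then have "\<Union>{fst g | g. g \<in> set L \<and> fst g \<inter> lightcone q C \<noteq> {}} \<subseteq> {..<n}" by blast
  moreover have "lightcone q C \<subseteq> {..<n}" using snoc by auto
  ultimately show ?case unfolding lightcone_snoc by (rule Un_least[rotated])
qed (use assms(2) in \<open>simp add: lightcone_def\<close>)

text \<open>By disjointness each qubit of \<open>S\<close> lies in at most one support and so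
  contributes at most \<open>r\<close> qubits. The summand \<open>1\<close> in the factor accounts
  for \<open>S\<close> itself, which stays in the set even where no gate acts.\<close>

lemma card_touching_gates:
  assumes L: "valid_layer n r E L" and S: "finite S"
  shows "card (S \<union> \<Union>{fst g | g. g \<in> set L \<and> fst g \<inter> S \<noteq> {}}) \<le> (r + 1) * card S"
proof -
  define T where "T s = \<Union>{fst g | g. g \<in> set L \<and> s \<in> fst g}" for s
  have T: "finite (T s) \<and> card (T s) \<le> r" for s
  proof (cases "\<exists>g\<in>set L. s \<in> fst g")
    case True
    then obtain i where i: "i < length L" "s \<in> fst (L ! i)" by (auto simp: in_set_conv_nth)
    have "fst g = fst (L ! i)" if g: "g \<in> set L" "s \<in> fst g" for g
    proof -
      obtain j where j: "j < length L" "g = L ! j" using g by (auto simp: in_set_conv_nth)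
      have "i = j" using L i j g unfolding valid_layer_def by blast
      then show ?thesis using j by simp
    qed
    then have "T s \<subseteq> fst (L ! i)" unfolding T_def by blast
    moreover have "fst (L ! i) \<subseteq> T s"
      unfolding T_def using i by (intro Union_upper CollectI exI[of _ "L ! i"]) auto
    ultimately have "T s = fst (L ! i)" by blast
    moreover have "valid_gate n r E (L ! i)" using L i by (simp add: valid_layer_def)
    ultimately show ?thesis using valid_gateD by simp
  next
    case False
    then have "T s = {}" by (auto simp: T_def)
    then show ?thesis by simp
  qed
  have "S \<union> \<Union>{fst g | g. g \<in> set L \<and> fst g \<inter> S \<noteq> {}} \<subseteq> S \<union> (\<Union>s\<in>S. T s)"
    unfolding T_def by blast
  then have "card (S \<union> \<Union>{fst g | g. g \<in> set L \<and> fst g \<inter> S \<noteq> {}}) \<le> card (S \<union> (\<Union>s\<in>S. T s))"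
    using S T by (intro card_mono) auto
  also have "\<dots> \<le> card S + card (\<Union>s\<in>S. T s)" by (rule card_Un_le)
  also have "card (\<Union>s\<in>S. T s) \<le> (\<Sum>s\<in>S. card (T s))" by (rule card_UN_le[OF S])
  also have "\<dots> \<le> (\<Sum>s\<in>S. r)" using T by (intro sum_mono) auto
  finally show ?thesis by (simp add: algebra_simps)
qed

lemma card_lightcone_le:
  assumes "\<forall>L\<in>set C. valid_layer n r E L" "q < n"
  shows "card (lightcone q C) \<le> (r + 1) ^ length C"
  using assms(1)
proof (induction C rule: rev_induct)
  case (snoc L C)
  have "finite (lightcone q C)"
    using lightcone_subset[of C n r E q] snoc.prems assms(2) by (auto intro: finite_subset)
  then have "card (lightcone q (C @ [L])) \<le> (r + 1) * card (lightcone q C)"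
    unfolding lightcone_snoc using snoc.prems by (intro card_touching_gates[of n r E]) auto
  also have "\<dots> \<le> (r + 1) * (r + 1) ^ length C" using snoc by (intro mult_left_mono) auto
  finally show ?case by simp
qed (simp add: lightcone_def)

text \<open>A ball in the cycle around \<open>q\<close>. The offset is an integer so that steps in
  both directions, including those across the end of the numbering, are treated alike.\<close>

definition cycle_ball :: "nat \<Rightarrow> nat \<Rightarrow> nat \<Rightarrow> nat set" where
  "cycle_ball n q m = {x. x < n \<and> (\<exists>i. \<bar>i\<bar> \<le> int m \<and> int x = (int q + i) mod int n)}"

lemma card_cycle_ball_le: "card (cycle_ball n q m) \<le> 2 * m + 1"
proof -
  have "x \<in> (\<lambda>i. nat ((int q + i) mod int n)) ` {- int m..int m}" if x: "x \<in> cycle_ball n q m" for x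
  proof -
    obtain i where "\<bar>i\<bar> \<le> int m" "int x = (int q + i) mod int n" using x by (auto simp: cycle_ball_def)
    then show ?thesis by (intro image_eqI[of _ _ i]) auto
  qed
  then have "cycle_ball n q m \<subseteq> (\<lambda>i. nat ((int q + i) mod int n)) ` {- int m..int m}" by blast
  then have "card (cycle_ball n q m) \<le> card {- int m..int m}" by (rule surj_card_le[rotated]) simp
  then show ?thesis by simp
qed

lemma cycle_ball_step:
  assumes "x \<in> cycle_ball n q m" "(x, y) \<in> cycle_architecture n"
  shows "y \<in> cycle_ball n q (Suc m)"
proof -
  obtain i where i: "\<bar>i\<bar> \<le> int m" "int x = (int q + i) mod int n"
    using assms(1) by (auto simp: cycle_ball_def)
  have xy: "x < n" "y < n" "y = (x + 1) mod n \<or> x = (y + 1) mod n"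
    using assms(2) by (auto simp: cycle_architecture_def)
  from xy(3) show ?thesis
  proof
    assume "y = (x + 1) mod n"
    then have "int y = (int q + (i + 1)) mod int n"
      using i by (simp add: zmod_int mod_simps algebra_simps)
    then show ?thesis using xy i by (auto simp: cycle_ball_def intro!: exI[of _ "i + 1"])
  next
    assume "x = (y + 1) mod n"
    then have "(int x - 1) mod int n = int y"
      using xy by (simp add: zmod_int mod_simps)
    then have "int y = (int q + (i - 1)) mod int n"
      unfolding i(2) by (simp add: mod_simps algebra_simps)
    then show ?thesis using xy i by (auto simp: cycle_ball_def intro!: exI[of _ "i - 1"])
  qed
qed

lemma cycle_ball_mono: "m \<le> m' \<Longrightarrow> cycle_ball n q m \<subseteq> cycle_ball n q m'"
  unfolding cycle_ball_def by force

lemma cycle_ball_relpow: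
  assumes "R \<subseteq> cycle_architecture n" "x \<in> cycle_ball n q m" "(x, y) \<in> R ^^ k"
  shows "y \<in> cycle_ball n q (m + k)"
  using assms(3)
proof (induction k arbitrary: y)
  case (Suc k)
  then obtain z where "(x, z) \<in> R ^^ k" "(z, y) \<in> R" by auto
  then show ?case using Suc.IH cycle_ball_step[of z n q "m + k" y] assms(1) by auto
qed (use assms(2) in simp)

text \<open>Two vertices of \<open>S\<close> are joined by a walk that is no longer than the number
  of edges inside \<open>S\<close>, which is at most \<open>r * r\<close>. This crude diameter bound
  only affects the constant in the depth bound.\<close>

lemma connected_subset_cycle_ball:
  assumes "connected_in E S" "E \<subseteq> cycle_architecture n" "finite S" "card S \<le> r"
    and "x \<in> S" "x \<in> cycle_ball n q m"
  shows "S \<subseteq> cycle_ball n q (m + r * r)"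
proof
  fix y assume "y \<in> S"
  let ?R = "E \<inter> S \<times> S"
  have fin: "finite ?R" using assms(3) by simp
  have "(x, y) \<in> ?R\<^sup>*" using assms(1,5) \<open>y \<in> S\<close> unfolding connected_in_def by blast
  then obtain k where k: "k \<le> card ?R" "(x, y) \<in> ?R ^^ k"
    using rtrancl_finite_eq_relpow[OF fin] by auto
  have "card ?R \<le> card (S \<times> S)" using assms(3) by (intro card_mono) auto
  also have "\<dots> \<le> r * r" using assms(4) by (simp add: card_cartesian_product mult_mono)
  finally have "m + k \<le> m + r * r" using k(1) by simp
  moreover have "y \<in> cycle_ball n q (m + k)"
    using cycle_ball_relpow[of ?R n x q m y k] assms(2,6) k(2) by auto
  ultimately show "y \<in> cycle_ball n q (m + r * r)" using cycle_ball_mono by blast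
qed

lemma lightcone_subset_cycle_ball:
  assumes "\<forall>L\<in>set C. valid_layer n r E L" "q < n" "E \<subseteq> cycle_architecture n"
  shows "lightcone q C \<subseteq> cycle_ball n q (r * r * length C)"
  using assms(1)
proof (induction C rule: rev_induct)
  case Nil
  then show ?case using assms(2) by (simp add: lightcone_def cycle_ball_def)
next
  case (snoc L C)
  have IH: "lightcone q C \<subseteq> cycle_ball n q (r * r * length C)" using snoc by auto
  have len: "r * r * length (C @ [L]) = r * r * length C + r * r" by simp
  have "fst g \<subseteq> cycle_ball n q (r * r * length (C @ [L]))"
    if g: "g \<in> set L" "fst g \<inter> lightcone q C \<noteq> {}" for g
  proof -
    have "valid_gate n r E g" using snoc.prems g by (auto simp: valid_layer_def)
    note v = valid_gateD[OF this]
    obtain x where x: "x \<in> fst g" "x \<in> lightcone q C" using g(2) by blast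
    show ?thesis unfolding len
      by (rule connected_subset_cycle_ball[OF v(4) assms(3) v(2,3) x(1)]) (use x IH in auto)
  qed
  moreover have "lightcone q C \<subseteq> cycle_ball n q (r * r * length (C @ [L]))"
    using IH cycle_ball_mono[of "r * r * length C" "r * r * length (C @ [L])" n q] by simp
  ultimately show ?case unfolding lightcone_snoc by blast
qed

lemma path_subset_cycle: "path_architecture n \<subseteq> cycle_architecture n"
  by (auto simp: path_architecture_def cycle_architecture_def)

lemma depth_lower_bound_cycle:
  assumes "\<forall>L\<in>set C. valid_layer n r E L" "q < n" "E \<subseteq> cycle_architecture n" "8 \<le> n"
    and "real n / 4 \<le> real (card (lightcone q C))"
  shows "1 / (16 * (real r ^ 2 + 1)) * real n \<le> real (length C)"
proof -
  have "finite (cycle_ball n q m)" for m by (simp add: cycle_ball_def)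
  then have "card (lightcone q C) \<le> card (cycle_ball n q (r * r * length C))"
    using lightcone_subset_cycle_ball[OF assms(1-3)] by (intro card_mono)
  also have "\<dots> \<le> 2 * (r * r * length C) + 1" by (rule card_cycle_ball_le)
  finally have "real (card (lightcone q C)) \<le> real (2 * (r * r * length C) + 1)" by linarith
  then have "real n / 4 \<le> 2 * real r ^ 2 * real (length C) + 1"
    using assms(5) by (simp add: power2_eq_square)
  \<comment> \<open>The centre of the ball accounts for the additive \<open>1\<close>, which
    \<open>8 \<le> n\<close> absorbs at the cost of half of \<open>n / 4\<close>.\<close>
  moreover have "real n / 8 \<le> real n / 4 - 1" using assms(4) by simp
  ultimately have "real n / 8 \<le> 2 * real r ^ 2 * real (length C)" by linarith
  \<comment> \<open>The extra \<open>1\<close> keeps the denominator positive when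
    \<open>r = 0\<close>.\<close>
  also have "\<dots> \<le> 2 * (real r ^ 2 + 1) * real (length C)" by (simp add: algebra_simps)
  finally have "real n \<le> real (length C) * (16 * (real r ^ 2 + 1))" by (simp add: algebra_simps)
  then show ?thesis by (simp add: pos_divide_le_eq add_nonneg_pos)
qed

lemma depth_lower_bound_complete:
  assumes "\<forall>L\<in>set C. valid_layer n r E L" "q < n" "16 \<le> n"
    and "real n / 4 \<le> real (card (lightcone q C))"
  shows "1 / (2 * ln (real r + 2)) * ln (real n) \<le> real (length C)"
proof -
  have l: "0 < ln (real r + 2)" by simp
  have "real (card (lightcone q C)) \<le> real ((r + 1) ^ length C)"
    using card_lightcone_le[OF assms(1,2)] by (simp only: of_nat_le_iff)
  \<comment> \<open>Base \<open>r + 2\<close> rather than \<open>r + 1\<close>, so that its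
    logarithm is positive even for \<open>r = 0\<close>.\<close>
  also have "\<dots> \<le> (real r + 2) ^ length C" by (simp add: power_mono)
  finally have "ln (real n / 4) \<le> ln ((real r + 2) ^ length C)"
    using assms(3,4) by (subst ln_le_cancel_iff) auto
  then have 1: "ln (real n) - ln 4 \<le> real (length C) * ln (real r + 2)"
    using assms(3) by (simp add: ln_div ln_realpow)
  \<comment> \<open>For \<open>16 \<le> n\<close> the loss \<open>ln 4\<close> from the fraction
    \<open>1 / 4\<close> is at most half of \<open>ln n\<close>; this is the origin of the factor
    \<open>2\<close> in the constant.\<close>
  have "2 * ln 4 = ln (4 ^ 2 :: real)" by (subst ln_realpow) auto
  also have "\<dots> \<le> ln (real n)" using assms(3) by (subst ln_le_cancel_iff) auto
  finally have "ln (real n) \<le> real (length C) * (2 * ln (real r + 2))" using 1 by linarith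
  then show ?thesis using l by (simp add: pos_divide_le_eq)
qed

lemma ensemble_depth_ge:
  assumes "C \<in> space M" "c \<le> real (length C)"
  shows "ereal c \<le> ensemble_depth M"
proof -
  have "ereal c \<le> ereal (real (length C))" using assms(2) by simp
  also have "\<dots> \<le> ensemble_depth M" unfolding ensemble_depth_def using assms(1) by (rule SUP_upper)
  finally show ?thesis .
qed

section \<open>Correlations of the evolved test state\<close>

lemma sum_lessThan_mult:
  fixes f :: "nat \<Rightarrow> 'a::comm_monoid_add"
  shows "(\<Sum>i<m * k. f i) = (\<Sum>a<m. \<Sum>c<k. f (a * k + c))"
proof -
  have "sum f {a * k..<a * k + k} = (\<Sum>c<k. f (a * k + c))" for a
    using sum.shift_bounds_nat_ivl[of f 0 "a * k" k] by (simp add: atLeast0LessThan add.commute)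
  then show ?thesis by (simp flip: sum.nat_group)
qed

lemma mult_add_less: "a < m \<Longrightarrow> c < k \<Longrightarrow> a * k + c < m * (k :: nat)"
proof -
  assume "a < m" "c < k"
  then have "a * k + c < (a + 1) * k" "(a + 1) * k \<le> m * k" by (simp, intro mult_right_mono) auto
  then show ?thesis by linarith
qed

lemma kron_carrier [simp]:
  "A \<in> carrier_mat m m' \<Longrightarrow> B \<in> carrier_mat k k' \<Longrightarrow> kron A B \<in> carrier_mat (m * k) (m' * k')"
  by (auto simp: kron_def)

lemma kron_index:
  assumes "A \<in> carrier_mat m m'" "B \<in> carrier_mat k k'" "a < m" "a' < m'" "c < k" "c' < k'"
  shows "kron A B $$ (a * k + c, a' * k' + c') = A $$ (a, a') * B $$ (c, c')"
  using assms mult_add_less[of a m c k] mult_add_less[of a' m' c' k'] by (simp add: kron_def)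

lemma kron_adjoint: "mat_adjoint (kron A B) = kron (mat_adjoint A) (mat_adjoint B)"
proof (rule eq_matI)
  fix i j assume "i < dim_row (kron (mat_adjoint A) (mat_adjoint B))"
    "j < dim_col (kron (mat_adjoint A) (mat_adjoint B))"
  then have ij: "i < dim_col A * dim_col B" "j < dim_row A * dim_row B" by (auto simp: kron_def)
  then have "0 < dim_col B" "0 < dim_row B" by (auto intro: Nat.gr0I)
  then show "mat_adjoint (kron A B) $$ (i, j) = kron (mat_adjoint A) (mat_adjoint B) $$ (i, j)"
    using ij by (simp add: kron_def less_mult_imp_div_less)
qed (auto simp: kron_def)

lemma tensor_power_carrier [simp]:
  "U \<in> carrier_mat d d \<Longrightarrow> tensor_power k U \<in> carrier_mat (d ^ k) (d ^ k)"
  by (induction k) auto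

lemma tensor_power_adjoint: "tensor_power k (mat_adjoint U) = mat_adjoint (tensor_power k U)"
  by (induction k) (simp_all add: kron_adjoint)

lemma tensor_power_Suc_index:
  assumes "U \<in> carrier_mat d d" "i < d ^ Suc k" "j < d ^ Suc k"
  shows "tensor_power (Suc k) U $$ (i, j) =
    U $$ (i div d ^ k, j div d ^ k) * tensor_power k U $$ (i mod d ^ k, j mod d ^ k)"
  using assms carrier_matD[OF tensor_power_carrier[OF assms(1), of k]] by (simp add: kron_def)

lemma tensor_power_entry_le_1:
  assumes "U \<in> unitary_group d" "i < d ^ k" "j < d ^ k"
  shows "cmod (tensor_power k U $$ (i, j)) \<le> 1"
  using assms(2,3)
proof (induction k arbitrary: i j)
  case (Suc k)
  note U = unitary_groupD(1)[OF assms(1)]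
  have "0 < d" using Suc.prems by (auto intro: Nat.gr0I)
  then have "cmod (U $$ (i div d ^ k, j div d ^ k)) \<le> 1"
    "cmod (tensor_power k U $$ (i mod d ^ k, j mod d ^ k)) \<le> 1"
    using Suc by (auto intro!: unitary_entry_le_1[OF assms(1)] less_mult_imp_div_less)
  then show ?case unfolding tensor_power_Suc_index[OF U Suc.prems]
    by (simp add: norm_mult mult_le_one)
qed simp

text \<open>Column \<open>0\<close> is the evolved state of the padding copies, which start in the
  all-zero basis state; being normalised, it drops out of expectations on the other two
  copies.\<close>

lemma tensor_power_col_norm:
  assumes "U \<in> unitary_group d" "0 < d"
  shows "(\<Sum>i<d ^ k. (cmod (tensor_power k U $$ (i, 0)))\<^sup>2) = 1"
proof (induction k)
  case (Suc k)
  note U = unitary_groupD(1)[OF assms(1)]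
  have ent: "tensor_power (Suc k) U $$ (a * d ^ k + c, 0) = U $$ (a, 0) * tensor_power k U $$ (c, 0)"
    if "a < d" "c < d ^ k" for a c
    using kron_index[OF U tensor_power_carrier[OF U, of k] that(1) assms(2) that(2), of 0] assms(2) by simp
  have "(\<Sum>i<d ^ Suc k. (cmod (tensor_power (Suc k) U $$ (i, 0)))\<^sup>2) =
      (\<Sum>a<d. \<Sum>c<d ^ k. (cmod (U $$ (a, 0)))\<^sup>2 * (cmod (tensor_power k U $$ (c, 0)))\<^sup>2)"
    unfolding power_Suc sum_lessThan_mult
    by (intro sum.cong refl) (simp only: ent lessThan_iff norm_mult power_mult_distrib)
  also have "\<dots> = (\<Sum>a<d. (cmod (U $$ (a, 0)))\<^sup>2)"
    by (simp add: Suc flip: sum_distrib_left)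
  finally show ?case using unitary_col_norm[OF assms] by simp
qed simp

text \<open>The position of a \<otimes> b \<otimes> c in the order of the nested
  \<open>kron\<close>, with \<open>a\<close> and \<open>b\<close> for the two entangled copies and
  \<open>c\<close> for the remaining \<open>k\<close> copies taken together.\<close>

definition triple_index :: "nat \<Rightarrow> nat \<Rightarrow> nat \<Rightarrow> nat \<Rightarrow> nat \<Rightarrow> nat" where
  "triple_index d k a b c = a * (d * d ^ k) + (b * d ^ k + c)"

lemma triple_index_less:
  assumes "a < d" "b < d" "c < d ^ k"
  shows "triple_index d k a b c < d ^ (k + 2)"
  using mult_add_less[OF assms(1) mult_add_less[OF assms(2,3)]] by (simp add: triple_index_def mult_ac)

lemma sum_triple_index:
  "(\<Sum>i<d ^ (k + 2). f i) = (\<Sum>a<d. \<Sum>b<d. \<Sum>c<d ^ k. f (triple_index d k a b c))"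
proof -
  have "d ^ (k + 2) = d * (d * d ^ k)" by simp
  then show ?thesis by (simp only: sum_lessThan_mult triple_index_def)
qed

lemma tensor_power_triple_index:
  assumes U: "U \<in> carrier_mat d d" and "a < d" "b < d" "c < d ^ k" "a' < d" "b' < d" "c' < d ^ k"
  shows "tensor_power (k + 2) U $$ (triple_index d k a b c, triple_index d k a' b' c') =
    U $$ (a, a') * U $$ (b, b') * tensor_power k U $$ (c, c')"
proof -
  have W: "tensor_power k U \<in> carrier_mat (d ^ k) (d ^ k)" using U by simp
  have K: "kron U (tensor_power k U) \<in> carrier_mat (d * d ^ k) (d * d ^ k)" using U W by simp
  show ?thesis
    using kron_index[OF U K assms(2,5) mult_add_less[OF assms(3,4)] mult_add_less[OF assms(6,7)]]
      kron_index[OF U W assms(3,6,4,7)]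
    by (simp add: triple_index_def numeral_2_eq_2)
qed

text \<open>The Pauli matrix \<open>i Y\<close> on qubit \<open>q\<close>, which is real and antisymmetric, so that its
  conjugates by orthogonal matrices have a vanishing diagonal.\<close>

definition pauli_iY :: "nat \<Rightarrow> nat \<Rightarrow> complex mat" where
  "pauli_iY n q = mat (2 ^ n) (2 ^ n) (\<lambda>(x, y). if x = flip_bit q y then if bit y q then 1 else -1 else 0)"

lemma pauli_iY_carrier [simp]: "pauli_iY n q \<in> carrier_mat (2 ^ n) (2 ^ n)"
  by (simp add: pauli_iY_def)

lemma pauli_iY_index:
  "x < 2 ^ n \<Longrightarrow> y < 2 ^ n \<Longrightarrow>
    pauli_iY n q $$ (x, y) = (if x = flip_bit q y then if bit y q then 1 else -1 else 0)"
  by (simp add: pauli_iY_def)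

lemma pauli_iY_antisym:
  assumes "x < 2 ^ n" "y < 2 ^ n"
  shows "pauli_iY n q $$ (y, x) = - pauli_iY n q $$ (x, y)"
proof -
  have "y = flip_bit q x \<longleftrightarrow> x = flip_bit q y" by auto
  then show ?thesis using assms by (auto simp: pauli_iY_index)
qed

lemma pauli_iY_unitary:
  assumes "q < n"
  shows "pauli_iY n q \<in> unitary_group (2 ^ n)"
proof -
  let ?B = "pauli_iY n q"
  have B: "?B \<in> carrier_mat (2 ^ n) (2 ^ n)" by simp
  have "mat_adjoint ?B * ?B = 1\<^sub>m (2 ^ n)"
  proof (rule eq_matI)
    fix x y assume "x < dim_row (1\<^sub>m (2 ^ n) :: complex mat)" "y < dim_col (1\<^sub>m (2 ^ n) :: complex mat)"
    then have xy: "x < 2 ^ n" "y < 2 ^ n" by auto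
    have "(mat_adjoint ?B * ?B) $$ (x, y) = (\<Sum>z<2^n. mat_adjoint ?B $$ (x, z) * ?B $$ (z, y))"
      using B xy by (intro index_mult_mat_sum) auto
    also have "\<dots> = (\<Sum>z<2^n. if z = flip_bit q y then cnj (?B $$ (z, x)) * ?B $$ (z, y) else 0)"
      using xy carrier_matD[OF B] by (intro sum.cong refl) (auto simp: pauli_iY_index)
    also have "\<dots> = cnj (?B $$ (flip_bit q y, x)) * ?B $$ (flip_bit q y, y)"
      using assms xy by simp
    also have "\<dots> = 1\<^sub>m (2 ^ n) $$ (x, y)"
    proof -
      have "flip_bit q y = flip_bit q x \<longleftrightarrow> x = y" by (metis flip_bit_flip_bit)
      then show ?thesis using assms xy by (simp add: pauli_iY_index)
    qed
    finally show "(mat_adjoint ?B * ?B) $$ (x, y) = 1\<^sub>m (2 ^ n) $$ (x, y)" .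
  qed (auto simp: pauli_iY_def)
  then show ?thesis using B by (simp add: unitary_group_def)
qed

lemma pauli_iY_local: "q < n \<Longrightarrow> local_on n {q} (pauli_iY n q)"
proof -
  assume q: "q < n"
  have "flip_bit p x = flip_bit q (flip_bit p y) \<longleftrightarrow> x = flip_bit q y" for p x y :: nat
  proof -
    have "flip_bit q (flip_bit p y) = flip_bit p (flip_bit q y)" by (rule bit_eqI) auto
    then show ?thesis by (metis flip_bit_flip_bit)
  qed
  then show ?thesis using q by (auto simp: local_on_def pauli_iY_index)
qed

text \<open>The order is \<open>U B U\<^sup>\<dagger>\<close>, as for an operator carried along by
  the evolved state, not \<open>U\<^sup>\<dagger> B U\<close> as for an observable.\<close>

definition heisenberg :: "nat \<Rightarrow> nat \<Rightarrow> complex mat \<Rightarrow> complex mat" where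
  "heisenberg n q U = U * pauli_iY n q * mat_adjoint U"

lemma heisenberg_unitary:
  "q < n \<Longrightarrow> U \<in> unitary_group (2 ^ n) \<Longrightarrow> heisenberg n q U \<in> unitary_group (2 ^ n)"
  unfolding heisenberg_def by (intro unitary_group_mult unitary_group_adjoint pauli_iY_unitary)

lemma heisenberg_index:
  assumes "U \<in> carrier_mat (2 ^ n) (2 ^ n)" "a < 2 ^ n" "b < 2 ^ n"
  shows "heisenberg n q U $$ (a, b) =
    (\<Sum>x<2^n. \<Sum>y<2^n. U $$ (a, x) * pauli_iY n q $$ (x, y) * cnj (U $$ (b, y)))"
proof -
  have "heisenberg n q U $$ (a, b) =
      (\<Sum>x<2^n. \<Sum>y<2^n. U $$ (a, x) * pauli_iY n q $$ (x, y) * mat_adjoint U $$ (y, b))"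
    unfolding heisenberg_def using assms by (intro index_mult_mat3_sum) auto
  also have "\<dots> = (\<Sum>x<2^n. \<Sum>y<2^n. U $$ (a, x) * pauli_iY n q $$ (x, y) * cnj (U $$ (b, y)))"
    using assms by (intro sum.cong refl) simp
  finally show ?thesis .
qed

lemma orthogonal_groupD:
  assumes "U \<in> orthogonal_group d"
  shows "U \<in> unitary_group d" "U \<in> carrier_mat d d" "\<And>i j. i < d \<Longrightarrow> j < d \<Longrightarrow> cnj (U $$ (i, j)) = U $$ (i, j)"
  using assms unitary_groupD(1)[of U d] by (auto simp: orthogonal_group_def Reals_cnj_iff)

text \<open>For real \<open>U\<close> the adjoint is the transpose, and a congruence by
  \<open>U\<close> and its transpose preserves antisymmetry. For a general unitary this
  fails.\<close>

lemma heisenberg_antisym: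
  assumes U: "U \<in> orthogonal_group (2 ^ n)" and ab: "a < 2 ^ n" "b < 2 ^ n"
  shows "heisenberg n q U $$ (b, a) = - heisenberg n q U $$ (a, b)"
proof -
  note U' = orthogonal_groupD[OF U]
  have "heisenberg n q U $$ (b, a) =
      (\<Sum>x<2^n. \<Sum>y<2^n. U $$ (b, x) * pauli_iY n q $$ (x, y) * U $$ (a, y))"
    unfolding heisenberg_index[OF U'(2) ab(2,1)] using ab by (intro sum.cong refl) (simp add: U'(3))
  also have "\<dots> = (\<Sum>x<2^n. \<Sum>y<2^n. U $$ (b, y) * pauli_iY n q $$ (y, x) * U $$ (a, x))"
    by (rule sum.swap)
  also have "\<dots> = (\<Sum>x<2^n. \<Sum>y<2^n. - (U $$ (a, x) * pauli_iY n q $$ (x, y) * U $$ (b, y)))"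
  proof (intro sum.cong refl)
    fix x y :: nat assume "x \<in> {..<2^n}" "y \<in> {..<2^n}"
    then show "U $$ (b, y) * pauli_iY n q $$ (y, x) * U $$ (a, x) =
        - (U $$ (a, x) * pauli_iY n q $$ (x, y) * U $$ (b, y))"
      using pauli_iY_antisym[of x n y q] by simp
  qed
  also have "\<dots> = - heisenberg n q U $$ (a, b)"
    unfolding heisenberg_index[OF U'(2) ab] sum_negf[symmetric]
    using ab by (intro sum.cong refl) (simp add: U'(3))
  finally show ?thesis .
qed

text \<open>The test state is \<open>(iY\<^sub>q \<otimes> 1)\<close> applied to the maximally entangled state of the first two
  copies, times \<open>|0\<dots>0>\<close> on the remaining \<open>k\<close> copies. A real \<open>U\<close> applied to every copy
  acts on the first two as \<open>B \<mapsto> U B U\<^sup>\<dagger>\<close>.\<close>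

definition test_vector :: "nat \<Rightarrow> nat \<Rightarrow> nat \<Rightarrow> nat \<Rightarrow> complex" where
  "test_vector n k q i = (let d = 2 ^ n; b = i mod (d * d ^ k) in
     if b mod d ^ k = 0 then pauli_iY n q $$ (i div (d * d ^ k), b div d ^ k) / sqrt (real d) else 0)"

lemma test_vector_triple_index:
  fixes n :: nat
  defines "d \<equiv> 2 ^ n"
  assumes "a < d" "b < d" "c < d ^ k"
  shows "test_vector n k q (triple_index d k a b c) =
    (if c = 0 then pauli_iY n q $$ (a, b) / sqrt (real d) else 0)"
  using assms mult_add_less[OF assms(3,4)]
  by (simp add: test_vector_def triple_index_def Let_def flip: d_def)

definition test_state :: "nat \<Rightarrow> nat \<Rightarrow> nat \<Rightarrow> complex mat" where
  "test_state n k q = mat ((2 ^ n) ^ (k + 2)) ((2 ^ n) ^ (k + 2))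
     (\<lambda>(i, j). test_vector n k q i * cnj (test_vector n k q j))"

lemma test_state_carrier [simp]:
  "test_state n k q \<in> carrier_mat ((2 ^ n) ^ (k + 2)) ((2 ^ n) ^ (k + 2))"
  by (simp add: test_state_def)

lemma test_state_trace_norm:
  assumes "q < n"
  shows "trace_norm (test_state n k q) = 1"
  unfolding test_state_def
proof (rule trace_norm_rank_one)
  define d :: nat where "d = 2 ^ n"
  have d: "0 < d" by (simp add: d_def)
  have "(\<Sum>i<d ^ (k + 2). (cmod (test_vector n k q i))\<^sup>2) =
      (\<Sum>a<d. \<Sum>b<d. \<Sum>c<d ^ k. if c = 0 then (cmod (pauli_iY n q $$ (a, b)))\<^sup>2 / d else 0)"
    unfolding sum_triple_index
  proof (intro sum.cong refl)
    fix a b c assume "a \<in> {..<d}" "b \<in> {..<d}" "c \<in> {..<d ^ k}"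
    then show "(cmod (test_vector n k q (triple_index d k a b c)))\<^sup>2 =
        (if c = 0 then (cmod (pauli_iY n q $$ (a, b)))\<^sup>2 / d else 0)"
      using test_vector_triple_index[of a n b c k q]
      by (simp add: norm_divide power_divide flip: d_def)
  qed
  also have "\<dots> = (\<Sum>a<d. (\<Sum>b<d. (cmod (pauli_iY n q $$ (a, b)))\<^sup>2) / d)"
    using d by (simp add: sum_divide_distrib)
  also have "\<dots> = (\<Sum>a<d. 1 / d)"
    using unitary_row_norm[OF pauli_iY_unitary[OF assms]] by (intro sum.cong refl) (simp add: d_def)
  also have "\<dots> = 1" using d by simp
  finally show "(\<Sum>i<(2 ^ n) ^ (k + 2). (cmod (test_vector n k q i))\<^sup>2) = 1" by (simp add: d_def)
qed

text \<open>Conjugating a rank one projection gives the rank one matrix of the transformed vector,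
  so only the image \<phi> of the test vector has to be computed.\<close>

lemma twirl_integrand_entry:
  fixes n k q :: nat
  assumes U: "U \<in> orthogonal_group (2 ^ n)" and ij: "i < (2 ^ n) ^ (k + 2)" "j < (2 ^ n) ^ (k + 2)"
  defines "\<phi> \<equiv> \<lambda>i. \<Sum>l<(2 ^ n) ^ (k + 2). tensor_power (k + 2) U $$ (i, l) * test_vector n k q l"
  shows "(tensor_power (k + 2) U * test_state n k q * tensor_power (k + 2) (mat_adjoint U)) $$ (i, j)
    = \<phi> i * cnj (\<phi> j)"
proof -
  let ?D = "(2 ^ n) ^ (k + 2) :: nat"
  let ?T = "tensor_power (k + 2) U"
  have T: "?T \<in> carrier_mat ?D ?D" by (rule tensor_power_carrier[OF orthogonal_groupD(2)[OF U]])
  have "(?T * test_state n k q * tensor_power (k + 2) (mat_adjoint U)) $$ (i, j) =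
      (\<Sum>x<?D. \<Sum>y<?D. ?T $$ (i, x) * test_state n k q $$ (x, y) * mat_adjoint ?T $$ (y, j))"
    unfolding tensor_power_adjoint using T ij
    by (intro index_mult_mat3_sum[OF T test_state_carrier]) auto
  also have "\<dots> = (\<Sum>x<?D. \<Sum>y<?D. (?T $$ (i, x) * test_vector n k q x) *
      cnj (?T $$ (j, y) * test_vector n k q y))"
    using carrier_matD[OF T] ij by (intro sum.cong refl) (simp add: test_state_def mult_ac)
  also have "\<dots> = \<phi> i * cnj (\<phi> j)"
    unfolding \<phi>_def cnj_sum sum_product ..
  finally show ?thesis .
qed

text \<open>The identity (U \<otimes> U) vec(B) = vec(U B U^T) in coordinates; the padding copies
  contribute column \<open>0\<close> of their tensor power as a separate factor.\<close>

lemma evolved_test_vector: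
  fixes n q :: nat
  defines "d \<equiv> 2 ^ n"
  assumes U: "U \<in> orthogonal_group d" and abc: "a < d" "b < d" "c < d ^ k"
  shows "(\<Sum>l<d ^ (k + 2). tensor_power (k + 2) U $$ (triple_index d k a b c, l) * test_vector n k q l)
    = heisenberg n q U $$ (a, b) * tensor_power k U $$ (c, 0) / sqrt (real d)"
proof -
  note U' = orthogonal_groupD[OF U]
  have d: "0 < d" by (simp add: d_def)
  have "(\<Sum>l<d ^ (k + 2). tensor_power (k + 2) U $$ (triple_index d k a b c, l) * test_vector n k q l)
    = (\<Sum>x<d. \<Sum>y<d. \<Sum>z<d ^ k. if z = 0 then U $$ (a, x) * U $$ (b, y) * tensor_power k U $$ (c, 0) *
        (pauli_iY n q $$ (x, y) / sqrt (real d)) else 0)"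
    unfolding sum_triple_index
  proof (intro sum.cong refl)
    fix x y z assume "x \<in> {..<d}" "y \<in> {..<d}" "z \<in> {..<d ^ k}"
    then show "tensor_power (k + 2) U $$ (triple_index d k a b c, triple_index d k x y z) *
        test_vector n k q (triple_index d k x y z) =
        (if z = 0 then U $$ (a, x) * U $$ (b, y) * tensor_power k U $$ (c, 0) *
        (pauli_iY n q $$ (x, y) / sqrt (real d)) else 0)"
      using test_vector_triple_index[of x n y z k q] tensor_power_triple_index[OF U'(2) abc, of x y z]
      by (simp flip: d_def)
  qed
  \<comment> \<open>Here the reality of \<open>U\<close> enters: replacing
    \<open>U $$ (b, y)\<close> by its conjugate turns the transpose into the adjoint.\<close>
  also have "\<dots> = (\<Sum>x<d. \<Sum>y<d. U $$ (a, x) * pauli_iY n q $$ (x, y) * cnj (U $$ (b, y)) *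
      (tensor_power k U $$ (c, 0) / sqrt (real d)))"
    using d abc by (intro sum.cong refl) (simp add: U'(3) mult_ac)
  also have "\<dots> = heisenberg n q U $$ (a, b) * (tensor_power k U $$ (c, 0) / sqrt (real d))"
    using heisenberg_index[OF U'(2)[unfolded d_def] abc(1,2)[unfolded d_def], of q]
    by (simp add: sum_distrib_right sum_divide_distrib flip: d_def)
  finally show ?thesis by simp
qed

text \<open>The permutation of basis states effected by Pauli X on qubit \<open>j\<close> in each of
  the first two copies, with the identity on the others.\<close>

definition pair_flip :: "nat \<Rightarrow> nat \<Rightarrow> nat \<Rightarrow> nat \<Rightarrow> nat" where
  "pair_flip n k j i = (let d = 2 ^ n; r = i mod (d * d ^ k) in
     triple_index d k (flip_bit j (i div (d * d ^ k))) (flip_bit j (r div d ^ k)) (r mod d ^ k))"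

lemma pair_flip_triple_index:
  fixes n :: nat
  defines "d \<equiv> 2 ^ n"
  assumes "a < d" "b < d" "c < d ^ k"
  shows "pair_flip n k j (triple_index d k a b c) = triple_index d k (flip_bit j a) (flip_bit j b) c"
  using assms mult_add_less[OF assms(3,4)]
  by (simp add: pair_flip_def triple_index_def Let_def flip: d_def)

lemma triple_index_cases:
  assumes "i < d ^ (k + 2)"
  obtains a b c where "a < d" "b < d" "c < d ^ k" "i = triple_index d k a b c"
proof -
  have i: "i < d * (d * d ^ k)" using assms by (simp add: mult_ac)
  then have pos: "0 < d" "0 < d ^ k" by (auto intro: Nat.gr0I)
  have "i div (d * d ^ k) < d" using i by (intro less_mult_imp_div_less)
  moreover have "i mod (d * d ^ k) div d ^ k < d" using pos by (intro less_mult_imp_div_less) simp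
  moreover have "i mod (d * d ^ k) mod d ^ k < d ^ k" using pos by simp
  moreover have "i = triple_index d k (i div (d * d ^ k)) (i mod (d * d ^ k) div d ^ k) (i mod (d * d ^ k) mod d ^ k)"
    by (simp only: triple_index_def div_mult_mod_eq)
  ultimately show ?thesis using that by blast
qed

lemma pair_flip_involution:
  assumes "j < n" "i < (2 ^ n) ^ (k + 2)"
  shows "pair_flip n k j i < (2 ^ n) ^ (k + 2)" "pair_flip n k j (pair_flip n k j i) = i"
proof -
  obtain a b c where abc: "a < 2 ^ n" "b < 2 ^ n" "c < (2 ^ n) ^ k" "i = triple_index (2 ^ n) k a b c"
    using triple_index_cases[OF assms(2)] .
  have f: "flip_bit j a < 2 ^ n" "flip_bit j b < 2 ^ n" using abc assms(1) by auto
  show "pair_flip n k j i < (2 ^ n) ^ (k + 2)"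
    unfolding abc(4) pair_flip_triple_index[OF abc(1-3)] by (rule triple_index_less[OF f abc(3)])
  show "pair_flip n k j (pair_flip n k j i) = i"
    unfolding abc(4) pair_flip_triple_index[OF abc(1-3)] pair_flip_triple_index[OF f abc(3)] by simp
qed

text \<open>The expectation of \<open>X\<^sub>j \<otimes> X\<^sub>j\<close> in the test state after applying \<open>U\<close> to every copy.\<close>

definition XX_correlation :: "nat \<Rightarrow> nat \<Rightarrow> nat \<Rightarrow> complex mat \<Rightarrow> complex" where
  "XX_correlation n q j U = (\<Sum>a<2^n. \<Sum>b<2^n.
     heisenberg n q U $$ (flip_bit j a, flip_bit j b) * cnj (heisenberg n q U $$ (a, b))) / 2 ^ n"

text \<open>The left side is the trace of the evolved state against the permutation matrix of
  \<open>pair_flip\<close>. It factorises, and the padding copies contribute only their squared norm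
  \<open>1\<close>.\<close>

lemma XX_correlation_eq:
  assumes U: "U \<in> orthogonal_group (2 ^ n)" and j: "j < n"
  shows "(\<Sum>i<(2 ^ n) ^ (k + 2). (tensor_power (k + 2) U * test_state n k q *
      tensor_power (k + 2) (mat_adjoint U)) $$ (pair_flip n k j i, i)) = XX_correlation n q j U"
proof -
  define d :: nat where "d = 2 ^ n"
  have d: "0 < d" by (simp add: d_def)
  let ?P = "heisenberg n q U"
  let ?W = "tensor_power k U"
  define \<phi> where "\<phi> i = (\<Sum>l<d ^ (k + 2). tensor_power (k + 2) U $$ (i, l) * test_vector n k q l)" for i
  have \<phi>: "\<phi> (triple_index d k a b c) = ?P $$ (a, b) * ?W $$ (c, 0) / sqrt (real d)"
    if "a < d" "b < d" "c < d ^ k" for a b c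
    using evolved_test_vector[OF U that[unfolded d_def], of q] by (simp only: \<phi>_def d_def)
  have fl: "flip_bit j a < d" if "a < d" for a using that j unfolding d_def by simp
  have "(\<Sum>i<d ^ (k + 2). (tensor_power (k + 2) U * test_state n k q *
      tensor_power (k + 2) (mat_adjoint U)) $$ (pair_flip n k j i, i)) =
      (\<Sum>i<d ^ (k + 2). \<phi> (pair_flip n k j i) * cnj (\<phi> i))"
    unfolding \<phi>_def d_def using pair_flip_involution(1)[OF j]
    by (intro sum.cong refl twirl_integrand_entry[OF U]) auto
  also have "\<dots> = (\<Sum>a<d. \<Sum>b<d. \<Sum>c<d ^ k.
      ?P $$ (flip_bit j a, flip_bit j b) * cnj (?P $$ (a, b)) / d * of_real ((cmod (?W $$ (c, 0)))\<^sup>2))"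
    unfolding sum_triple_index
  proof (intro sum.cong refl)
    fix a b c assume "a \<in> {..<d}" "b \<in> {..<d}" "c \<in> {..<d ^ k}"
    then have abc: "a < d" "b < d" "c < d ^ k" by auto
    have s: "complex_of_real (sqrt (real d)) * complex_of_real (sqrt (real d)) = of_nat d"
      by (simp flip: of_real_mult)
    have "pair_flip n k j (triple_index d k a b c) = triple_index d k (flip_bit j a) (flip_bit j b) c"
      unfolding d_def by (rule pair_flip_triple_index) (use abc in \<open>simp_all add: d_def\<close>)
    then show "\<phi> (pair_flip n k j (triple_index d k a b c)) * cnj (\<phi> (triple_index d k a b c)) =
      ?P $$ (flip_bit j a, flip_bit j b) * cnj (?P $$ (a, b)) / d * of_real ((cmod (?W $$ (c, 0)))\<^sup>2)"
      using abc fl by (simp only: \<phi> complex_norm_square) (simp add: s mult_ac)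
  qed
  also have "\<dots> = (\<Sum>a<d. \<Sum>b<d. ?P $$ (flip_bit j a, flip_bit j b) * cnj (?P $$ (a, b)) / d)"
  proof (intro sum.cong refl)
    have "(\<Sum>c<d ^ k. complex_of_real ((cmod (?W $$ (c, 0)))\<^sup>2)) =
        of_real (\<Sum>c<d ^ k. (cmod (?W $$ (c, 0)))\<^sup>2)"
      by (simp only: of_real_sum)
    also have "\<dots> = 1"
      using tensor_power_col_norm[OF orthogonal_groupD(1)[OF U], of k] d by (simp flip: d_def)
    finally have "(\<Sum>c<d ^ k. complex_of_real ((cmod (?W $$ (c, 0)))\<^sup>2)) = 1" .
    then show "(\<Sum>c<d ^ k. x * complex_of_real ((cmod (?W $$ (c, 0)))\<^sup>2)) = x" for x
      by (simp only: sum_distrib_left[symmetric] mult_1_right)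
  qed
  also have "\<dots> = XX_correlation n q j U"
    by (simp add: XX_correlation_def sum_divide_distrib d_def)
  finally show ?thesis by (simp only: d_def)
qed

lemma unitary_norm_sum:
  assumes "P \<in> unitary_group d"
  shows "(\<Sum>a<d. \<Sum>b<d. (cmod (P $$ (a, b)))\<^sup>2) = real d"
  using unitary_row_norm[OF assms] by simp

text \<open>Outside the support, conjugation by X on qubit \<open>j\<close> fixes P, so the
  correlation is the normalised squared Hilbert-Schmidt norm of a unitary.\<close>

lemma XX_correlation_local:
  assumes U: "U \<in> unitary_group (2 ^ n)" and q: "q < n" and j: "j < n" "j \<notin> S"
    and loc: "local_on n S (heisenberg n q U)"
  shows "XX_correlation n q j U = 1"
proof -
  let ?P = "heisenberg n q U"
  have "(\<Sum>a<2^n. \<Sum>b<2^n. ?P $$ (flip_bit j a, flip_bit j b) * cnj (?P $$ (a, b))) =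
      (\<Sum>a<2^n. \<Sum>b<2^n. complex_of_real ((cmod (?P $$ (a, b)))\<^sup>2))"
    by (intro sum.cong refl) (simp only: lessThan_iff local_on_flip[OF loc j] complex_norm_square)
  also have "\<dots> = of_real (\<Sum>a<2^n. \<Sum>b<2^n. (cmod (?P $$ (a, b)))\<^sup>2)" by (simp only: of_real_sum)
  also have "\<dots> = 2 ^ n" unfolding unitary_norm_sum[OF heisenberg_unitary[OF q U]] by simp
  finally show ?thesis by (simp add: XX_correlation_def)
qed

text \<open>Flipping both indices permutes the entries of P, so the products are controlled by the
  mean of two equal sums of squares.\<close>

lemma XX_correlation_bound:
  assumes U: "U \<in> unitary_group (2 ^ n)" and q: "q < n" and j: "j < n"
  shows "cmod (XX_correlation n q j U) \<le> 1"
proof -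
  let ?P = "heisenberg n q U"
  note P = unitary_norm_sum[OF heisenberg_unitary[OF q U]]
  have bij: "bij_betw (flip_bit j) {..<2^n} {..<2^n :: nat}" by (rule flip_bit_bij[OF j])
  have fl: "(\<Sum>a<2^n. \<Sum>b<2^n. (cmod (?P $$ (flip_bit j a, flip_bit j b)))\<^sup>2) = 2 ^ n"
    using P by (simp add: sum.reindex_bij_betw[OF bij, of "\<lambda>b. (cmod (?P $$ (_, b)))\<^sup>2"]
      sum.reindex_bij_betw[OF bij, of "\<lambda>a. \<Sum>b<2^n. (cmod (?P $$ (a, b)))\<^sup>2"])
  have "cmod (\<Sum>a<2^n. \<Sum>b<2^n. ?P $$ (flip_bit j a, flip_bit j b) * cnj (?P $$ (a, b))) \<le>
      (\<Sum>a<2^n. \<Sum>b<2^n. ((cmod (?P $$ (flip_bit j a, flip_bit j b)))\<^sup>2 + (cmod (?P $$ (a, b)))\<^sup>2) / 2)"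
  proof (intro sum_norm_le)
    fix a b :: nat
    have "0 \<le> (cmod (?P $$ (flip_bit j a, flip_bit j b)) - cmod (?P $$ (a, b)))\<^sup>2" by simp
    then show "cmod (?P $$ (flip_bit j a, flip_bit j b) * cnj (?P $$ (a, b))) \<le>
       ((cmod (?P $$ (flip_bit j a, flip_bit j b)))\<^sup>2 + (cmod (?P $$ (a, b)))\<^sup>2) / 2"
      by (simp add: norm_mult power2_diff)
  qed
  also have "\<dots> = 2 ^ n" using P fl by (simp add: sum.distrib flip: sum_divide_distrib)
  finally show ?thesis by (simp add: XX_correlation_def norm_divide norm_power)
qed

section \<open>Averages over the ensemble and over Haar measure\<close>

lemma mat_borel_generators:
  "{{A \<in> carrier_mat d d. A $$ (i, j) \<in> B} | i j B. i < d \<and> j < d \<and> B \<in> sets borel}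
    \<subseteq> Pow (carrier_mat d d :: complex mat set)"
  by auto

lemma space_mat_borel [simp]: "space (mat_borel d) = carrier_mat d d"
  unfolding mat_borel_def using mat_borel_generators by (rule space_measure_of)

lemma mat_entry_measurable:
  assumes "i < d" "j < d"
  shows "(\<lambda>U. U $$ (i, j)) \<in> borel_measurable (mat_borel d)"
proof (rule measurableI)
  fix B :: "complex set" assume B: "B \<in> sets borel"
  have "(\<lambda>U. U $$ (i, j)) -` B \<inter> space (mat_borel d) = {A \<in> carrier_mat d d. A $$ (i, j) \<in> B}"
    by auto
  also have "\<dots> \<in> sets (mat_borel d)"
    unfolding mat_borel_def sets_measure_of[OF mat_borel_generators]
    using assms B by (intro sigma_sets.Basic) blast
  finally show "(\<lambda>U. U $$ (i, j)) -` B \<inter> space (mat_borel d) \<in> sets (mat_borel d)" .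
qed simp

text \<open>Supports the change of variables in Haar invariance. The generators only test single
  entries, and each entry of the product is a linear combination of entries.\<close>

lemma mat_mult_measurable:
  assumes V: "V \<in> carrier_mat d d"
  shows "(\<lambda>U. V * U) \<in> measurable (mat_borel d) (mat_borel d)"
  unfolding mat_borel_def[of d]
proof (rule measurable_measure_of[OF mat_borel_generators], fold mat_borel_def)
  show "(\<lambda>U. V * U) \<in> space (mat_borel d) \<rightarrow> carrier_mat d d" using V by auto
  fix Y :: "complex mat set"
  assume "Y \<in> {{A \<in> carrier_mat d d. A $$ (i, j) \<in> B} | i j B. i < d \<and> j < d \<and> B \<in> sets borel}"
  then obtain i j B where Y: "Y = {A \<in> carrier_mat d d. A $$ (i, j) \<in> B}"
    and ij: "i < d" "j < d" and B: "B \<in> sets borel" by blast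
  have "(\<lambda>U. \<Sum>k<d. V $$ (i, k) * U $$ (k, j)) \<in> borel_measurable (mat_borel d)"
    using ij by (intro borel_measurable_sum borel_measurable_times borel_measurable_const mat_entry_measurable) auto
  from measurable_sets[OF this B]
  have "{U \<in> carrier_mat d d. (\<Sum>k<d. V $$ (i, k) * U $$ (k, j)) \<in> B} \<in> sets (mat_borel d)"
    by (simp add: vimage_def Int_def conj_commute)
  also have "{U \<in> carrier_mat d d. (\<Sum>k<d. V $$ (i, k) * U $$ (k, j)) \<in> B} =
      (\<lambda>U. V * U) -` Y \<inter> space (mat_borel d)"
    using V ij by (auto simp: Y index_mult_mat_sum[OF V _ ij] simp del: index_mult_mat(1))
  finally show "(\<lambda>U. V * U) -` Y \<inter> space (mat_borel d) \<in> sets (mat_borel d)" .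
qed

lemma borel_measurable_cnj:
  "f \<in> borel_measurable M \<Longrightarrow> (\<lambda>x. cnj (f x)) \<in> borel_measurable M"
  by (rule borel_measurable_continuous_on[OF continuous_on_cnj[OF continuous_on_id]])

lemma heisenberg_entry_measurable:
  assumes "a < 2 ^ n" "b < 2 ^ n"
  shows "(\<lambda>U. heisenberg n q U $$ (a, b)) \<in> borel_measurable (mat_borel (2 ^ n))"
proof -
  have "(\<lambda>U. \<Sum>x<2^n. \<Sum>y<2^n. U $$ (a, x) * pauli_iY n q $$ (x, y) * cnj (U $$ (b, y)))
      \<in> borel_measurable (mat_borel (2 ^ n))"
    using assms by (intro borel_measurable_sum borel_measurable_times borel_measurable_const
        borel_measurable_cnj mat_entry_measurable) auto
  then show ?thesis
    using heisenberg_index[OF _ assms] by (subst measurable_cong) auto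
qed

lemma XX_correlation_measurable:
  assumes "j < n"
  shows "XX_correlation n q j \<in> borel_measurable (mat_borel (2 ^ n))"
  unfolding XX_correlation_def[abs_def] using assms
  by (intro borel_measurable_divide borel_measurable_sum borel_measurable_times borel_measurable_const
      borel_measurable_cnj heisenberg_entry_measurable) auto

lemma tensor_power_entry_measurable:
  assumes "i < d ^ k" "j < d ^ k"
  shows "(\<lambda>U. tensor_power k U $$ (i, j)) \<in> borel_measurable (mat_borel d)"
  using assms
proof (induction k arbitrary: i j)
  case (Suc k)
  have "0 < d" using Suc.prems by (auto intro: Nat.gr0I)
  then have "(\<lambda>U. U $$ (i div d ^ k, j div d ^ k) * tensor_power k U $$ (i mod d ^ k, j mod d ^ k))
      \<in> borel_measurable (mat_borel d)"
    using Suc by (intro borel_measurable_times mat_entry_measurable Suc.IH) (auto intro!: less_mult_imp_div_less)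
  then show ?case using tensor_power_Suc_index[OF _ Suc.prems] by (subst measurable_cong) auto
qed simp

lemma twirl_integrand_index:
  assumes "U \<in> carrier_mat d d" "A \<in> carrier_mat (d ^ k) (d ^ k)" "i < d ^ k" "j < d ^ k"
  shows "(tensor_power k U * A * tensor_power k (mat_adjoint U)) $$ (i, j) =
    (\<Sum>x<d ^ k. \<Sum>y<d ^ k. tensor_power k U $$ (i, x) * A $$ (x, y) * cnj (tensor_power k U $$ (j, y)))"
proof -
  note T = tensor_power_carrier[OF assms(1), of k]
  have "(tensor_power k U * A * tensor_power k (mat_adjoint U)) $$ (i, j) = (\<Sum>x<d ^ k. \<Sum>y<d ^ k.
      tensor_power k U $$ (i, x) * A $$ (x, y) * mat_adjoint (tensor_power k U) $$ (y, j))"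
    unfolding tensor_power_adjoint by (rule index_mult_mat3_sum) (use T assms in auto)
  also have "\<dots> = (\<Sum>x<d ^ k. \<Sum>y<d ^ k.
      tensor_power k U $$ (i, x) * A $$ (x, y) * cnj (tensor_power k U $$ (j, y)))"
    using carrier_matD[OF T] assms by (intro sum.cong refl) simp
  finally show ?thesis .
qed

lemma twirl_integrand_measurable:
  assumes "A \<in> carrier_mat (d ^ k) (d ^ k)" "i < d ^ k" "j < d ^ k"
  shows "(\<lambda>U. (tensor_power k U * A * tensor_power k (mat_adjoint U)) $$ (i, j))
    \<in> borel_measurable (mat_borel d)"
proof -
  have "(\<lambda>U. \<Sum>x<d ^ k. \<Sum>y<d ^ k. tensor_power k U $$ (i, x) * A $$ (x, y) * cnj (tensor_power k U $$ (j, y)))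
     \<in> borel_measurable (mat_borel d)"
    using assms by (intro borel_measurable_sum borel_measurable_times borel_measurable_const
        borel_measurable_cnj tensor_power_entry_measurable) auto
  then show ?thesis using twirl_integrand_index[OF _ assms] by (subst measurable_cong) auto
qed

text \<open>The bound does not depend on \<open>U\<close>, since entries of tensor powers of a
  unitary have modulus at most \<open>1\<close>; this is what makes the entrywise expectations
  genuine integrals.\<close>

lemma twirl_integrand_bound:
  assumes U: "U \<in> unitary_group d" and "A \<in> carrier_mat (d ^ k) (d ^ k)" "i < d ^ k" "j < d ^ k"
  shows "cmod ((tensor_power k U * A * tensor_power k (mat_adjoint U)) $$ (i, j))
    \<le> (\<Sum>x<d ^ k. \<Sum>y<d ^ k. cmod (A $$ (x, y)))"
  unfolding twirl_integrand_index[OF unitary_groupD(1)[OF U] assms(2-4)]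
proof (intro sum_norm_le)
  fix x y assume "x \<in> {..<d ^ k}" "y \<in> {..<d ^ k}"
  then have "cmod (tensor_power k U $$ (i, x)) \<le> 1" "cmod (tensor_power k U $$ (j, y)) \<le> 1"
    using assms by (auto intro!: tensor_power_entry_le_1[OF U])
  then have "cmod (tensor_power k U $$ (i, x)) * cmod (A $$ (x, y)) * cmod (tensor_power k U $$ (j, y))
      \<le> 1 * cmod (A $$ (x, y)) * 1"
    by (intro mult_mono) auto
  then show "cmod (tensor_power k U $$ (i, x) * A $$ (x, y) * cnj (tensor_power k U $$ (j, y)))
      \<le> cmod (A $$ (x, y))" by (simp add: norm_mult)
qed

lemma integrable_on_unitary:
  fixes f :: "complex mat \<Rightarrow> complex"
  assumes "prob_space \<nu>" "sets \<nu> = sets (mat_borel d)" "AE U in \<nu>. U \<in> G"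
    and "f \<in> borel_measurable (mat_borel d)" "\<And>U. U \<in> G \<Longrightarrow> cmod (f U) \<le> c"
  shows "integrable \<nu> f"
proof -
  interpret prob_space \<nu> by fact
  show ?thesis
  proof (rule integrable_const_bound)
    show "AE U in \<nu>. cmod (f U) \<le> c" using assms(3) by eventually_elim (rule assms(5))
    show "f \<in> borel_measurable \<nu>" using assms(4) measurable_cong_sets[OF assms(2) refl] by blast
  qed
qed

text \<open>A finite sum of entries commutes with the entrywise expectation. The pointwise
  evaluation is valid for orthogonal matrices, hence almost everywhere.\<close>

lemma twirl_correlation:
  assumes \<nu>: "prob_space \<nu>" "sets \<nu> = sets (mat_borel (2 ^ n))" "AE U in \<nu>. U \<in> orthogonal_group (2 ^ n)"
    and j: "j < n"
  shows "(\<Sum>i<(2 ^ n) ^ (k + 2). twirl (2 ^ n) (k + 2) \<nu> (test_state n k q) $$ (pair_flip n k j i, i))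
    = (\<integral>U. XX_correlation n q j U \<partial>\<nu>)"
proof -
  define d D :: nat where "d = 2 ^ n" and "D = d ^ (k + 2)"
  define f where "f i U = (tensor_power (k + 2) U * test_state n k q *
    tensor_power (k + 2) (mat_adjoint U)) $$ (pair_flip n k j i, i)" for i U
  have X: "test_state n k q \<in> carrier_mat (d ^ (k + 2)) (d ^ (k + 2))"
    unfolding d_def by (rule test_state_carrier)
  have \<pi>: "pair_flip n k j i < d ^ (k + 2)" if "i < D" for i
    using pair_flip_involution(1)[OF j] that by (simp only: D_def d_def)
  have "integrable \<nu> (f i)" if "i < D" for i
    unfolding f_def
    by (rule integrable_on_unitary[OF \<nu>(1) \<nu>(2)[folded d_def] \<nu>(3)[folded d_def]
        twirl_integrand_measurable[OF X \<pi>[OF that] that[unfolded D_def]] twirl_integrand_bound[OF _ X \<pi>[OF that] that[unfolded D_def]]])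
      (rule orthogonal_groupD)
  then have "(\<integral>U. (\<Sum>i<D. f i U) \<partial>\<nu>) = (\<Sum>i<D. \<integral>U. f i U \<partial>\<nu>)"
    by (intro Bochner_Integration.integral_sum) auto
  also have "\<dots> = (\<Sum>i<D. twirl d (k + 2) \<nu> (test_state n k q) $$ (pair_flip n k j i, i))"
    using \<pi> unfolding f_def twirl_def D_def by (intro sum.cong refl) (simp del: power_add)
  finally have "(\<Sum>i<D. twirl d (k + 2) \<nu> (test_state n k q) $$ (pair_flip n k j i, i))
      = (\<integral>U. (\<Sum>i<D. f i U) \<partial>\<nu>)" ..
  also have "\<dots> = (\<integral>U. XX_correlation n q j U \<partial>\<nu>)"
  proof (rule integral_cong_AE)
    have cb: "borel_measurable \<nu> = (borel_measurable (mat_borel d) :: (complex mat \<Rightarrow> complex) set)"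
      using measurable_cong_sets[OF \<nu>(2) refl] by (simp add: d_def)
    show "(\<lambda>U. \<Sum>i<D. f i U) \<in> borel_measurable \<nu>"
      unfolding cb f_def
      by (intro borel_measurable_sum twirl_integrand_measurable[OF X])
        (simp_all only: lessThan_iff \<pi>[folded D_def] D_def[symmetric])
    show "XX_correlation n q j \<in> borel_measurable \<nu>"
      unfolding cb d_def by (rule XX_correlation_measurable[OF j])
    show "AE U in \<nu>. (\<Sum>i<D. f i U) = XX_correlation n q j U"
      using \<nu>(3) by eventually_elim (simp only: f_def D_def d_def XX_correlation_eq[OF _ j])
  qed
  finally show ?thesis by (simp only: D_def d_def)
qed

section \<open>Haar averages of the correlations\<close>

definition sign_flip :: "nat \<Rightarrow> nat \<Rightarrow> complex mat" where
  "sign_flip d a = mat d d (\<lambda>(x, y). if y = x then if x = a then -1 else 1 else 0)"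

lemma sign_flip_orthogonal: "sign_flip d a \<in> orthogonal_group d"
proof -
  let ?V = "sign_flip d a"
  have V: "?V \<in> carrier_mat d d" by (simp add: sign_flip_def)
  have ent: "?V $$ (x, y) = (if y = x then if x = a then -1 else 1 else 0)" if "x < d" "y < d" for x y
    using that by (simp add: sign_flip_def)
  have "mat_adjoint ?V * ?V = 1\<^sub>m d"
  proof (rule eq_matI)
    fix x y assume "x < dim_row (1\<^sub>m d :: complex mat)" "y < dim_col (1\<^sub>m d :: complex mat)"
    then have xy: "x < d" "y < d" by auto
    have "(mat_adjoint ?V * ?V) $$ (x, y) = (\<Sum>z<d. mat_adjoint ?V $$ (x, z) * ?V $$ (z, y))"
      using V xy by (intro index_mult_mat_sum) auto
    also have "\<dots> = (\<Sum>z<d. if z = x then 1\<^sub>m d $$ (x, y) else 0)"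
      using xy carrier_matD[OF V] by (intro sum.cong refl) (auto simp: ent)
    finally show "(mat_adjoint ?V * ?V) $$ (x, y) = 1\<^sub>m d $$ (x, y)" using xy by simp
  qed (use V in auto)
  then show ?thesis using V ent by (auto simp: orthogonal_group_def unitary_group_def)
qed

text \<open>Conjugation by a diagonal sign matrix multiplies an entry by the signs at its row and
  its column, so it is negated exactly when one of the two indices is \<open>a\<close> and the other
  is not.\<close>

lemma heisenberg_sign_flip:
  assumes U: "U \<in> carrier_mat (2 ^ n) (2 ^ n)" and xy: "x < 2 ^ n" "y < 2 ^ n"
  shows "heisenberg n q (sign_flip (2 ^ n) a * U) $$ (x, y) =
    (if (x = a) = (y = a) then 1 else -1) * heisenberg n q U $$ (x, y)"
proof -
  let ?V = "sign_flip (2 ^ n) a"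
  let ?P = "heisenberg n q U"
  have V: "?V \<in> carrier_mat (2 ^ n) (2 ^ n)" by (rule orthogonal_groupD(2)[OF sign_flip_orthogonal])
  have P: "?P \<in> carrier_mat (2 ^ n) (2 ^ n)" using U by (simp add: heisenberg_def)
  have ent: "?V $$ (x, y) = (if y = x then if x = a then -1 else 1 else 0)" if "x < 2 ^ n" "y < 2 ^ n" for x y
    using that by (simp add: sign_flip_def)
  have "heisenberg n q (?V * U) = ?V * ?P * mat_adjoint ?V"
    unfolding heisenberg_def by (rule conjugate_mult[OF V U pauli_iY_carrier])
  then have "heisenberg n q (?V * U) $$ (x, y) =
      (\<Sum>k<2^n. \<Sum>l<2^n. ?V $$ (x, k) * ?P $$ (k, l) * mat_adjoint ?V $$ (l, y))"
    using index_mult_mat3_sum[OF V P _ xy] V by simp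
  also have "\<dots> = (\<Sum>k<2^n. \<Sum>l<2^n. if l = y then if k = x then
      (if (x = a) = (y = a) then 1 else -1) * ?P $$ (x, y) else 0 else 0)"
    using xy carrier_matD[OF V] by (intro sum.cong refl) (auto simp: ent)
  also have "\<dots> = (if (x = a) = (y = a) then 1 else -1) * ?P $$ (x, y)"
    using xy by simp
  finally show ?thesis .
qed

text \<open>The sign is settled separately for every pair of basis states, so the Haar integral is
  never evaluated; boundedness of the entries justifies exchanging sum and integral.\<close>

lemma haar_XX_correlation:
  assumes \<mu>: "is_haar (2 ^ n) (orthogonal_group (2 ^ n)) \<mu>" and q: "q < n" and j: "j < n"
  shows "Re (\<integral>U. XX_correlation n q j U \<partial>\<mu>) \<le> 0"
proof -
  define d :: nat where "d = 2 ^ n"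
  define g where "g a b U = heisenberg n q U $$ (flip_bit j a, flip_bit j b) * cnj (heisenberg n q U $$ (a, b))" for a b U
  have h: "prob_space \<mu>" "sets \<mu> = sets (mat_borel d)" "AE U in \<mu>. U \<in> orthogonal_group d"
    and inv: "\<And>V. V \<in> orthogonal_group d \<Longrightarrow> distr \<mu> (mat_borel d) (\<lambda>U. V * U) = \<mu>"
    using \<mu> unfolding is_haar_def d_def by auto
  have fl: "flip_bit j a < d" if "a < d" for a using that j by (simp add: d_def)
  have meas: "g a b \<in> borel_measurable (mat_borel d)" if "a < d" "b < d" for a b
    unfolding g_def d_def using that j unfolding d_def
    by (intro borel_measurable_times borel_measurable_cnj heisenberg_entry_measurable) auto
  have bound: "cmod (g a b U) \<le> 1" if "U \<in> orthogonal_group d" "a < d" "b < d" for a b U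
  proof -
    have "heisenberg n q U \<in> unitary_group d"
      using heisenberg_unitary[OF q] orthogonal_groupD(1)[OF that(1)] by (simp add: d_def)
    then have "cmod (heisenberg n q U $$ (x, y)) \<le> 1" if "x < d" "y < d" for x y
      using that by (rule unitary_entry_le_1)
    then show ?thesis using that fl by (simp add: g_def norm_mult mult_le_one)
  qed
  have int: "integrable \<mu> (g a b)" if "a < d" "b < d" for a b
    using integrable_on_unitary[OF h meas[OF that]] bound that by blast
  \<comment> \<open>Negating basis state \<open>a\<close> changes the sign of \<open>g a b\<close> unless \<open>a = b\<close> or \<open>b\<close> is the flip of \<open>a\<close>;
    in these cases antisymmetry gives \<open>0\<close> and a negative square.\<close>
  have nonpos: "Re (\<integral>U. g a b U \<partial>\<mu>) \<le> 0" if ab: "a < d" "b < d" for a b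
  proof (cases "a = b \<or> b = flip_bit j a")
    case True
    have "AE U in \<mu>. Re (g a b U) \<le> 0"
      using h(3)
    proof eventually_elim
      case (elim U)
      have anti: "heisenberg n q U $$ (y, x) = - heisenberg n q U $$ (x, y)" if "x < d" "y < d" for x y
        using heisenberg_antisym[of U n x y q] elim that by (simp add: d_def)
      show "Re (g a b U) \<le> 0"
      proof (cases "a = b")
        case True
        then have "heisenberg n q U $$ (a, b) = 0" using anti[OF ab] by simp
        then show ?thesis by (simp add: g_def)
      next
        case False
        then have b: "b = flip_bit j a" using True by simp
        then have "g a b U = - (heisenberg n q U $$ (a, b) * cnj (heisenberg n q U $$ (a, b)))"
          using anti[OF ab] by (simp add: g_def)
        also have "\<dots> = - of_real ((cmod (heisenberg n q U $$ (a, b)))\<^sup>2)"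
          by (simp only: complex_norm_square)
        finally have "Re (g a b U) = - (cmod (heisenberg n q U $$ (a, b)))\<^sup>2"
          by (simp only: uminus_complex.sel Re_complex_of_real)
        then show ?thesis by simp
      qed
    qed
    then have "(\<integral>U. Re (g a b U) \<partial>\<mu>) \<le> (\<integral>U. 0 \<partial>\<mu>)"
      by (intro integral_mono_AE integrable_Re int ab) auto
    then show ?thesis using integral_Re[OF int[OF ab]] by simp
  next
    case False
    let ?V = "sign_flip d a"
    have V: "?V \<in> carrier_mat d d" by (rule orthogonal_groupD(2)[OF sign_flip_orthogonal])
    have "(\<integral>U. g a b U \<partial>\<mu>) = (\<integral>U. g a b U \<partial>distr \<mu> (mat_borel d) (\<lambda>U. ?V * U))"
      by (simp only: inv[OF sign_flip_orthogonal])
    also have "\<dots> = (\<integral>U. g a b (?V * U) \<partial>\<mu>)"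
      using mat_mult_measurable[OF V] measurable_cong_sets[OF h(2) refl] meas[OF ab]
      by (intro integral_distr) auto
    also have "\<dots> = (\<integral>U. - g a b U \<partial>\<mu>)"
    proof (rule Bochner_Integration.integral_cong[OF refl])
      fix U assume "U \<in> space \<mu>"
      then have U: "U \<in> carrier_mat (2 ^ n) (2 ^ n)"
        using sets_eq_imp_space_eq[OF h(2)] by (simp add: d_def)
      \<comment> \<open>Among the four indices in \<open>g a b\<close> the state \<open>a\<close>
        now occurs just once, so exactly one of the two factors changes sign.\<close>
      have "flip_bit j a \<noteq> a" "flip_bit j b \<noteq> a" using False by auto
      then show "g a b (?V * U) = - g a b U"
        using False ab fl unfolding g_def d_def by (simp add: heisenberg_sign_flip[OF U])
    qed
    also have "\<dots> = - (\<integral>U. g a b U \<partial>\<mu>)" by simp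
    finally show ?thesis by simp
  qed
  have "(\<integral>U. XX_correlation n q j U \<partial>\<mu>) = (\<integral>U. (\<Sum>a<d. \<Sum>b<d. g a b U) / of_nat d \<partial>\<mu>)"
    by (simp add: XX_correlation_def g_def d_def)
  also have "\<dots> = (\<integral>U. (\<Sum>a<d. \<Sum>b<d. g a b U) \<partial>\<mu>) / of_nat d" by simp
  also have "(\<integral>U. (\<Sum>a<d. \<Sum>b<d. g a b U) \<partial>\<mu>) = (\<Sum>a<d. \<Sum>b<d. \<integral>U. g a b U \<partial>\<mu>)"
    using int by (subst Bochner_Integration.integral_sum)
      (auto intro!: sum.cong Bochner_Integration.integral_sum Bochner_Integration.integrable_sum)
  finally have "Re (\<integral>U. XX_correlation n q j U \<partial>\<mu>) = (\<Sum>a<d. \<Sum>b<d. Re (\<integral>U. g a b U \<partial>\<mu>)) / d"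
    by (simp add: Re_divide_of_nat)
  also have "\<dots> \<le> 0" using nonpos by (intro divide_nonpos_nonneg sum_nonpos) auto
  finally show ?thesis .
qed

section \<open>From the diamond norm to the lightcone bound\<close>

lemma ampliation_one:
  assumes "\<Phi> X \<in> carrier_mat d d" "X \<in> carrier_mat d d"
  shows "ampliation d 1 \<Phi> X = \<Phi> X"
proof -
  have "mat d d (\<lambda>(p, q). X $$ (p * 1 + i mod 1, q * 1 + j mod 1)) = X" for i j
    using assms(2) by (intro eq_matI) auto
  then show ?thesis using assms(1) by (intro eq_matI) (auto simp: ampliation_def)
qed

text \<open>A one-dimensional ancilla is among those in the supremum, and for it the ampliation is
  the map itself.\<close>

lemma trace_norm_le_diamond_norm:
  assumes "\<Phi> X \<in> carrier_mat d d" "X \<in> carrier_mat d d" "trace_norm X \<le> 1"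
    and "diamond_norm d \<Phi> \<le> ereal \<epsilon>"
  shows "trace_norm (\<Phi> X) \<le> \<epsilon>"
proof -
  have "ereal (trace_norm (ampliation d 1 \<Phi> X)) \<le> diamond_norm d \<Phi>"
    unfolding diamond_norm_def using assms(2,3) by (intro SUP_upper2[of "(1, X)"]) auto
  then have "ereal (trace_norm (\<Phi> X)) \<le> ereal \<epsilon>"
    unfolding ampliation_one[of \<Phi> X d, OF assms(1,2)] using assms(4) by (rule order.trans)
  then show ?thesis by simp
qed

text \<open>A qubit outside the lightcone contributes exactly \<open>1\<close>, one inside at least
  \<open>-1\<close>; so each qubit of the lightcone costs at most \<open>2\<close>.\<close>

lemma sum_XX_correlation_ge:
  assumes C: "\<forall>L\<in>set C. valid_layer n r E L" and q: "q < n"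
  shows "real n - 2 * real (card (lightcone q C)) \<le> (\<Sum>j<n. Re (XX_correlation n q j (circuit_unitary n C)))"
proof -
  let ?U = "circuit_unitary n C"
  have U: "?U \<in> unitary_group (2 ^ n)" by (rule circuit_unitary_unitary[OF C])
  have loc: "local_on n (lightcone q C) (heisenberg n q ?U)"
    unfolding heisenberg_def by (rule local_on_lightcone[OF C pauli_iY_carrier pauli_iY_local[OF q]])
  have sub: "lightcone q C \<subseteq> {..<n}" by (rule lightcone_subset[OF C q])
  have "real n - 2 * real (card (lightcone q C)) = (\<Sum>j<n. 1 - (if j \<in> lightcone q C then 2 else 0))"
  proof -
    have "(\<Sum>j<n. if j \<in> lightcone q C then 2 else 0) = (\<Sum>j\<in>lightcone q C. 2 :: real)"
      using sub by (simp add: sum.If_cases Int_absorb1)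
    then show ?thesis by (simp add: sum_subtractf)
  qed
  also have "\<dots> \<le> (\<Sum>j<n. Re (XX_correlation n q j ?U))"
  proof (rule sum_mono)
    fix j assume "j \<in> {..<n}"
    then have j: "j < n" by simp
    show "1 - (if j \<in> lightcone q C then 2 else 0) \<le> Re (XX_correlation n q j ?U)"
    proof (cases "j \<in> lightcone q C")
      case True
      then show ?thesis using XX_correlation_bound[OF U q j] abs_Re_le_cmod[of "XX_correlation n q j ?U"] by simp
    next
      case False
      then show ?thesis using XX_correlation_local[OF U q j False loc] by simp
    qed
  qed
  finally show ?thesis .
qed

lemma design_ensemble_valid:
  "orthogonal_design_ensemble n k \<epsilon> r E M \<Longrightarrow> C \<in> space M \<Longrightarrow> \<forall>L\<in>set C. valid_layer n r E L"
  unfolding orthogonal_design_ensemble_def circuit_ensemble_def by blast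

lemma design_lightcone:
  assumes k: "2 \<le> k" and \<epsilon>: "\<epsilon> < 1 / 4" and M: "orthogonal_design_ensemble n k \<epsilon> r E M" and q: "q < n"
  shows "\<exists>C\<in>space M. real n / 4 \<le> real (card (lightcone q C))"
proof (rule ccontr)
  assume "\<not> ?thesis"
  then have small: "real (card (lightcone q C)) < real n / 4" if "C \<in> space M" for C
    using that by fastforce
  \<comment> \<open>Two copies carry the entangled state; the other \<open>k'\<close> are
    padding.\<close>
  obtain k' where k': "k = k' + 2" using k by (metis le_add_diff_inverse2)
  define d D :: nat where "d = 2 ^ n" and "D = d ^ k"
  define \<nu> where "\<nu> = distr M (mat_borel d) (circuit_unitary n)"
  have ens: "prob_space M" "\<And>C. C \<in> space M \<Longrightarrow> \<forall>L\<in>set C. valid_layer n r E L"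
    "circuit_unitary n \<in> measurable M (mat_borel d)"
    "\<And>C. C \<in> space M \<Longrightarrow> circuit_unitary n C \<in> orthogonal_group d"
    "approx_design d k \<epsilon> (orthogonal_group d) \<nu>"
    using M unfolding orthogonal_design_ensemble_def circuit_ensemble_def \<nu>_def d_def by auto
  interpret M: prob_space M by (rule ens(1))
  obtain \<mu> where \<mu>: "is_haar d (orthogonal_group d) \<mu>"
    and dn: "diamond_norm D (\<lambda>A. twirl d k \<mu> A - twirl d k \<nu> A) \<le> ereal \<epsilon>"
    and \<nu>AE: "AE U in \<nu>. U \<in> orthogonal_group d"
    using ens(5) unfolding approx_design_def D_def by auto
  have \<nu>: "prob_space \<nu>" "sets \<nu> = sets (mat_borel d)"
    using M.prob_space_distr[OF ens(3)] by (auto simp: \<nu>_def)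
  have \<mu>': "prob_space \<mu>" "sets \<mu> = sets (mat_borel d)" "AE U in \<mu>. U \<in> orthogonal_group d"
    using \<mu> by (auto simp: is_haar_def)
  define X where "X = test_state n k' q"
  have X: "X \<in> carrier_mat D D" unfolding X_def D_def d_def k' by (rule test_state_carrier)
  define Y where "Y = twirl d k \<mu> X - twirl d k \<nu> X"
  have tw: "twirl d k \<xi> X \<in> carrier_mat D D" for \<xi> by (simp add: twirl_def D_def)
  have Y: "Y \<in> carrier_mat D D" unfolding Y_def by (rule minus_carrier_mat[OF tw])
  have tnY: "trace_norm Y \<le> \<epsilon>"
    using trace_norm_le_diamond_norm[of "\<lambda>A. twirl d k \<mu> A - twirl d k \<nu> A", OF _ X _ dn] Y
      test_state_trace_norm[OF q, of k'] by (simp add: Y_def X_def)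
  \<comment> \<open>For a fixed \<open>j\<close> the observable is a unitary, so its expectations in
    the two twirled states differ by at most the trace norm of \<open>Y\<close>; the Haar one is
    nonpositive.\<close>
  have gap: "Re (\<integral>U. XX_correlation n q j U \<partial>\<nu>) \<le> \<epsilon>" if j: "j < n" for j
  proof -
    have \<pi>: "pair_flip n k' j i < D" if "i < D" for i
      using pair_flip_involution(1)[OF j] that by (simp only: D_def d_def k')
    have \<pi>\<pi>: "pair_flip n k' j (pair_flip n k' j i) = i" if "i < D" for i
      using pair_flip_involution(2)[OF j] that by (simp only: D_def d_def k')
    have "(\<Sum>i<D. Y $$ (pair_flip n k' j i, i)) =
       (\<Sum>i<D. twirl d k \<mu> X $$ (pair_flip n k' j i, i) - twirl d k \<nu> X $$ (pair_flip n k' j i, i))"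
      using \<pi> carrier_matD[OF tw] by (intro sum.cong refl) (simp add: Y_def)
    also have "\<dots> = (\<integral>U. XX_correlation n q j U \<partial>\<mu>) - (\<integral>U. XX_correlation n q j U \<partial>\<nu>)"
      unfolding sum_subtractf X_def D_def d_def k'
      using twirl_correlation[of \<mu> n j k' q] twirl_correlation[of \<nu> n j k' q] \<mu>' \<nu> \<nu>AE j
      by (simp only: d_def)
    finally have "cmod ((\<integral>U. XX_correlation n q j U \<partial>\<mu>) - (\<integral>U. XX_correlation n q j U \<partial>\<nu>)) \<le> \<epsilon>"
      using trace_norm_involution[OF Y, of "pair_flip n k' j"] \<pi> \<pi>\<pi> tnY by simp
    then have "\<bar>Re (\<integral>U. XX_correlation n q j U \<partial>\<mu>) - Re (\<integral>U. XX_correlation n q j U \<partial>\<nu>)\<bar> \<le> \<epsilon>"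
      using abs_Re_le_cmod order.trans by fastforce
    then show ?thesis using haar_XX_correlation[OF \<mu>[unfolded d_def] q j] by linarith
  qed
  have int: "integrable M (\<lambda>C. XX_correlation n q j (circuit_unitary n C))" if j: "j < n" for j
  proof (rule M.integrable_const_bound)
    show "AE C in M. cmod (XX_correlation n q j (circuit_unitary n C)) \<le> 1"
      using XX_correlation_bound[OF _ q j] circuit_unitary_unitary[OF ens(2)] by (intro AE_I2) auto
    show "(\<lambda>C. XX_correlation n q j (circuit_unitary n C)) \<in> borel_measurable M"
      using XX_correlation_measurable[OF j, of q] ens(3) by (simp add: d_def measurable_compose)
  qed
  \<comment> \<open>Each circuit by itself gives at least n - 2 (n/4) = n/2, so the average over the
    ensemble does too.\<close>
  have "real n / 2 \<le> (\<integral>C. (\<Sum>j<n. Re (XX_correlation n q j (circuit_unitary n C))) \<partial>M)"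
  proof (rule M.integral_ge_const)
    show "integrable M (\<lambda>C. \<Sum>j<n. Re (XX_correlation n q j (circuit_unitary n C)))"
      using int by (intro Bochner_Integration.integrable_sum integrable_Re) auto
    show "AE C in M. real n / 2 \<le> (\<Sum>j<n. Re (XX_correlation n q j (circuit_unitary n C)))"
    proof (rule AE_I2)
      fix C assume "C \<in> space M"
      then show "real n / 2 \<le> (\<Sum>j<n. Re (XX_correlation n q j (circuit_unitary n C)))"
        using sum_XX_correlation_ge[OF ens(2) q, of C] small[of C] by linarith
    qed
  qed
  also have "\<dots> = (\<Sum>j<n. \<integral>C. Re (XX_correlation n q j (circuit_unitary n C)) \<partial>M)"
    using int by (intro Bochner_Integration.integral_sum integrable_Re) auto
  \<comment> \<open>The lightcone estimate concerns circuits, the design property the distribution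
    \<nu> of their unitaries; a change of variables connects the two.\<close>
  also have "\<dots> = (\<Sum>j<n. Re (\<integral>U. XX_correlation n q j U \<partial>\<nu>))"
  proof (intro sum.cong refl)
    fix j assume "j \<in> {..<n}"
    then have j: "j < n" by simp
    have "(\<integral>U. XX_correlation n q j U \<partial>\<nu>) = (\<integral>C. XX_correlation n q j (circuit_unitary n C) \<partial>M)"
      unfolding \<nu>_def using ens(3) XX_correlation_measurable[OF j, of q] by (intro integral_distr) (auto simp: d_def)
    then show "(\<integral>C. Re (XX_correlation n q j (circuit_unitary n C)) \<partial>M) = Re (\<integral>U. XX_correlation n q j U \<partial>\<nu>)"
      using integral_Re[OF int[OF j]] by simp
  qed
  also have "\<dots> \<le> (\<Sum>j<n. \<epsilon>)" using gap by (intro sum_mono) auto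
  also have "\<dots> = real n * \<epsilon>" by simp
  also have "\<dots> \<le> real n * (1 / 4)" using \<epsilon> by (intro mult_left_mono) auto
  \<comment> \<open>\<open>q < n\<close> makes \<open>n\<close> positive, so n/2 cannot be at most
    n/4.\<close>
  finally show False using q by simp
qed

theorem theoremS16:
  shows
    "(\<forall>n k \<epsilon> r E M q.
        2 \<le> k \<longrightarrow> \<epsilon> < 1 / 4 \<longrightarrow> architecture n E \<longrightarrow>
        orthogonal_design_ensemble n k \<epsilon> r E M \<longrightarrow> q < n \<longrightarrow>
        (\<exists>C\<in>space M. real n / 4 \<le> real (card (lightcone q C))))
   \<and> (\<forall>r. \<exists>c>0. \<exists>n0. \<forall>n\<ge>n0. \<forall>k \<epsilon> E M.
        2 \<le> k \<longrightarrow> \<epsilon> < 1 / 4 \<longrightarrow> E = path_architecture n \<or> E = cycle_architecture n \<longrightarrow>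
        orthogonal_design_ensemble n k \<epsilon> r E M \<longrightarrow>
        ereal (c * real n) \<le> ensemble_depth M)
   \<and> (\<forall>r. \<exists>c>0. \<exists>n0. \<forall>n\<ge>n0. \<forall>k \<epsilon> M.
        2 \<le> k \<longrightarrow> \<epsilon> < 1 / 4 \<longrightarrow>
        orthogonal_design_ensemble n k \<epsilon> r (complete_architecture n) M \<longrightarrow>
        ereal (c * ln (real n)) \<le> ensemble_depth M)"
proof (intro conjI allI)
  fix n k \<epsilon> r E M q
  show "2 \<le> k \<longrightarrow> \<epsilon> < 1 / 4 \<longrightarrow> architecture n E \<longrightarrow>
        orthogonal_design_ensemble n k \<epsilon> r E M \<longrightarrow> q < n \<longrightarrow>
        (\<exists>C\<in>space M. real n / 4 \<le> real (card (lightcone q C)))"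
    using design_lightcone by blast
next
  fix r :: nat
  define c where "c = 1 / (16 * (real r ^ 2 + 1))"
  have "0 < real r ^ 2 + 1" by (rule add_nonneg_pos) auto
  then have c: "0 < c" by (simp add: c_def)
  have "ereal (c * real n) \<le> ensemble_depth M"
    if n: "8 \<le> n" and h: "2 \<le> k" "\<epsilon> < 1 / 4" "E = path_architecture n \<or> E = cycle_architecture n"
      "orthogonal_design_ensemble n k \<epsilon> r E M" for n k \<epsilon> E M
  proof -
    have q: "0 < n" using n by simp
    obtain C where C: "C \<in> space M" "real n / 4 \<le> real (card (lightcone 0 C))"
      using design_lightcone[OF h(1,2,4) q] by blast
    \<comment> \<open>The path is a subgraph of the cycle, so one ball estimate serves both
      one-dimensional architectures.\<close>
    have "E \<subseteq> cycle_architecture n" using h(3) path_subset_cycle by blast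
    moreover have "\<forall>L\<in>set C. valid_layer n r E L" by (rule design_ensemble_valid[OF h(4) C(1)])
    ultimately have "c * real n \<le> real (length C)"
      unfolding c_def by (intro depth_lower_bound_cycle[OF _ q _ n C(2)])
    then show ?thesis by (rule ensemble_depth_ge[OF C(1)])
  qed
  with c show "\<exists>c>0. \<exists>n0. \<forall>n\<ge>n0. \<forall>k \<epsilon> E M.
        2 \<le> k \<longrightarrow> \<epsilon> < 1 / 4 \<longrightarrow> E = path_architecture n \<or> E = cycle_architecture n \<longrightarrow>
        orthogonal_design_ensemble n k \<epsilon> r E M \<longrightarrow>
        ereal (c * real n) \<le> ensemble_depth M" by blast
next
  fix r :: nat
  define c where "c = 1 / (2 * ln (real r + 2))"
  have c: "0 < c" by (simp add: c_def)
  have "ereal (c * ln (real n)) \<le> ensemble_depth M"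
    if n: "16 \<le> n" and h: "2 \<le> k" "\<epsilon> < 1 / 4"
      "orthogonal_design_ensemble n k \<epsilon> r (complete_architecture n) M" for n k \<epsilon> M
  proof -
    have q: "0 < n" using n by simp
    obtain C where C: "C \<in> space M" "real n / 4 \<le> real (card (lightcone 0 C))"
      using design_lightcone[OF h q] by blast
    have "c * ln (real n) \<le> real (length C)"
      unfolding c_def by (rule depth_lower_bound_complete[OF design_ensemble_valid[OF h(3) C(1)] q n C(2)])
    then show ?thesis by (rule ensemble_depth_ge[OF C(1)])
  qed
  with c show "\<exists>c>0. \<exists>n0. \<forall>n\<ge>n0. \<forall>k \<epsilon> M.
        2 \<le> k \<longrightarrow> \<epsilon> < 1 / 4 \<longrightarrow>
        orthogonal_design_ensemble n k \<epsilon> r (complete_architecture n) M \<longrightarrow>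
        ereal (c * ln (real n)) \<le> ensemble_depth M" by blast
qed

end
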